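(* Let $G$ be a cyclically $4$-edge-connected cubic graph with a $2$-factor $C$ containing exactly two odd circuits $N_1,N_2$ and at least one even circuit $W$. Let $x_1y_1$, $y_1y_2$, $y_2x_2$ be edges of $G$ with $x_1\in V(N_1)$, $x_2\in V(N_2)$ and $y_1,y_2\in V(W)$. For $i\in\{1,2\}$ let $u_i,v_i$ be the two neighbours of $x_i$ on $N_i$, and let $w_i$ be the neighbour of $y_i$ on $W$ different from $y_{3-i}$. Let $F=G-E(C)$ and let $M$ be a maximum matching in $C-\{x_1,y_1,y_2,x_2\}$. Let $Z$ be the set consisting of, for $i\in\{1,2\}$, the edges of $N_i$ not incident with $x_i$ but incident with $u_i$ or $v_i$, and the edges of $W$ incident with $w_i$ but not incident with $y_i$ (i.e. not incident with $y_1$ or $y_2$). Suppose that: (i) there exist a smooth orientation of the circuits of the subgraph with edge set $(E(F)\setminus\{x_1y_1,x_2y_2\})\cup M$ and a smooth orientation of $C$ which agree on all edges of $Z$; (ii) the graph $G\sim x_1y_1\sim x_2y_2$ is cyclically $3$-edge-connected; and (iii) $G\sim x_1y_1\sim x_2y_2$ has no cycle-separating $3$-edge-cut $\{e_1,e_2,e_3\}$ with $e_1\in\{u_1v_1,u_2v_2,w_1w_2\}$ and $e_2,e_3\in (E(F)\setminus\{x_1y_1,x_2y_2\})\cup M$. Then $fn(G)=2$.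
   Context: A circuit is a connected $2$-regular graph; a cycle is a graph in which every vertex has even degree. A graph is cyclically $k$-edge-connected if the removal of fewer than $k$ edges cannot separate it into two components that both contain a cycle; an edge-cut is cycle-separating if both sides contain a cycle. A smooth orientation of a set of edge-disjoint circuits is an orientation in which, for every circuit of the set, each vertex of that circuit has exactly one incoming and one outgoing edge of that circuit. For an edge $e$ of a cubic graph $G$, $G\sim e$ denotes the cubic graph obtained from $G-e$ by smoothing the two resulting vertices of degree $2$ (each is removed and its two neighbours are joined by a new edge); thus in $G\sim x_1y_1\sim x_2y_2$ the edges $u_1v_1$, $u_2v_2$, $w_1w_2$ are the new edges arising from smoothing, and the other edges are identified with edges of $G$. An orientation is strong if for every ordered pair of distinct vertices $u,v$ there is a directed $uv$-path. An edge is deletable in an orientation $(G,o)$ if the restriction of $o$ to the remaining edges is a strong orientation of the graph with that edge removed. For a $3$-edge-connected graph $G$, $fn(G)$ is the minimum number $k$ such that $G$ admits $k$ orientations with every edge deletable in at least one of them. *)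

theory Defs
  imports Main
begin

text \<open>Finite multigraphs (parallel edges and loops allowed).  Every edge e carries
  an (arbitrary, reference) ordered pair of end-vertices ends G e; a loop has equal ends.\<close>

record ('v, 'e) mgraph =
  verts :: "'v set"
  edges :: "'e set"
  ends  :: "'e \<Rightarrow> 'v \<times> 'v"

definition wf_graph :: "('v,'e) mgraph \<Rightarrow> bool" where
  "wf_graph G \<longleftrightarrow> finite (verts G) \<and> finite (edges G) \<and>
     (\<forall>e\<in>edges G. fst (ends G e) \<in> verts G \<and> snd (ends G e) \<in> verts G)"

definition incident :: "('v,'e) mgraph \<Rightarrow> 'e \<Rightarrow> 'v \<Rightarrow> bool" where
  "incident G e v \<longleftrightarrow> v = fst (ends G e) \<or> v = snd (ends G e)"

definition joins :: "('v,'e) mgraph \<Rightarrow> 'e \<Rightarrow> 'v \<Rightarrow> 'v \<Rightarrow> bool" where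
  "joins G e p q \<longleftrightarrow> ends G e = (p, q) \<or> ends G e = (q, p)"

text \<open>Degree of v in the spanning subgraph with edge set D (a loop counts twice).\<close>
definition degE :: "('v,'e) mgraph \<Rightarrow> 'e set \<Rightarrow> 'v \<Rightarrow> nat" where
  "degE G D v = card {e\<in>D. fst (ends G e) = v} + card {e\<in>D. snd (ends G e) = v}"

definition cubic :: "('v,'e) mgraph \<Rightarrow> bool" where
  "cubic G \<longleftrightarrow> wf_graph G \<and> (\<forall>v\<in>verts G. degE G (edges G) v = 3)"

text \<open>Vertices covered by an edge set.\<close>
definition vset :: "('v,'e) mgraph \<Rightarrow> 'e set \<Rightarrow> 'v set" where
  "vset G D = (\<Union>e\<in>D. {fst (ends G e), snd (ends G e)})"

definition adjrel :: "('v,'e) mgraph \<Rightarrow> 'e set \<Rightarrow> ('v \<times> 'v) set" where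
  "adjrel G D = {(u, v). \<exists>e\<in>D. joins G e u v}"

text \<open>A circuit: (edge set of) a connected 2-regular subgraph.\<close>
definition circuit :: "('v,'e) mgraph \<Rightarrow> 'e set \<Rightarrow> bool" where
  "circuit G D \<longleftrightarrow> D \<noteq> {} \<and> D \<subseteq> edges G \<and>
     (\<forall>v\<in>vset G D. degE G D v = 2) \<and>
     (\<forall>u\<in>vset G D. \<forall>v\<in>vset G D. (u, v) \<in> (adjrel G D)\<^sup>*)"

text \<open>A 2-factor: spanning 2-regular subgraph, given by its edge set.\<close>
definition two_factor :: "('v,'e) mgraph \<Rightarrow> 'e set \<Rightarrow> bool" where
  "two_factor G C \<longleftrightarrow> C \<subseteq> edges G \<and> (\<forall>v\<in>verts G. degE G C v = 2)"

definition cut :: "('v,'e) mgraph \<Rightarrow> 'v set \<Rightarrow> 'e set" where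
  "cut G X = {e\<in>edges G. (fst (ends G e) \<in> X) \<noteq> (snd (ends G e) \<in> X)}"

text \<open>The induced subgraph on X contains a cycle (equivalently a circuit).\<close>
definition has_cycle_in :: "('v,'e) mgraph \<Rightarrow> 'v set \<Rightarrow> bool" where
  "has_cycle_in G X \<longleftrightarrow> (\<exists>D. circuit G D \<and> vset G D \<subseteq> X)"

text \<open>The edge-cut determined by X is cycle-separating.\<close>
definition cycle_separating :: "('v,'e) mgraph \<Rightarrow> 'v set \<Rightarrow> bool" where
  "cycle_separating G X \<longleftrightarrow> X \<subseteq> verts G \<and> has_cycle_in G X \<and> has_cycle_in G (verts G - X)"

definition cyc_edge_conn :: "('v,'e) mgraph \<Rightarrow> nat \<Rightarrow> bool" where
  "cyc_edge_conn G k \<longleftrightarrow> (\<forall>X. cycle_separating G X \<longrightarrow> card (cut G X) \<ge> k)"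

text \<open>Orientations: ori e = False means e is directed fst -> snd, True means snd -> fst.\<close>
definition otail :: "('v,'e) mgraph \<Rightarrow> ('e \<Rightarrow> bool) \<Rightarrow> 'e \<Rightarrow> 'v" where
  "otail G ori e = (if ori e then snd (ends G e) else fst (ends G e))"

definition ohead :: "('v,'e) mgraph \<Rightarrow> ('e \<Rightarrow> bool) \<Rightarrow> 'e \<Rightarrow> 'v" where
  "ohead G ori e = (if ori e then fst (ends G e) else snd (ends G e))"

definition arcs :: "('v,'e) mgraph \<Rightarrow> ('e \<Rightarrow> bool) \<Rightarrow> ('v \<times> 'v) set" where
  "arcs G ori = {(otail G ori e, ohead G ori e) | e. e \<in> edges G}"

definition strong :: "('v,'e) mgraph \<Rightarrow> ('e \<Rightarrow> bool) \<Rightarrow> bool" where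
  "strong G ori \<longleftrightarrow> (\<forall>u\<in>verts G. \<forall>v\<in>verts G. u \<noteq> v \<longrightarrow> (u, v) \<in> (arcs G ori)\<^sup>+)"

definition deletable :: "('v,'e) mgraph \<Rightarrow> ('e \<Rightarrow> bool) \<Rightarrow> 'e \<Rightarrow> bool" where
  "deletable G ori e \<longleftrightarrow> e \<in> edges G \<and> strong (G\<lparr>edges := edges G - {e}\<rparr>) ori"

definition fn :: "('v,'e) mgraph \<Rightarrow> nat" where
  "fn G = (LEAST k. \<exists>Os :: nat \<Rightarrow> 'e \<Rightarrow> bool. \<forall>e\<in>edges G. \<exists>i<k. deletable G (Os i) e)"

text \<open>Smooth orientation of the circuits contained in the edge set S
  (applied only to edge sets of maximum degree at most 2, whose circuits are edge-disjoint).\<close>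
definition smooth_orient :: "('v,'e) mgraph \<Rightarrow> ('e \<Rightarrow> bool) \<Rightarrow> 'e set \<Rightarrow> bool" where
  "smooth_orient G ori S \<longleftrightarrow> (\<forall>D. circuit G D \<and> D \<subseteq> S \<longrightarrow>
     (\<forall>v\<in>vset G D. card {e\<in>D. ohead G ori e = v} = 1 \<and> card {e\<in>D. otail G ori e = v} = 1))"

definition matching :: "('v,'e) mgraph \<Rightarrow> 'e set \<Rightarrow> bool" where
  "matching G M \<longleftrightarrow> (\<forall>e\<in>M. fst (ends G e) \<noteq> snd (ends G e)) \<and>
     (\<forall>e\<in>M. \<forall>e'\<in>M. e \<noteq> e' \<longrightarrow>
        {fst (ends G e), snd (ends G e)} \<inter> {fst (ends G e'), snd (ends G e')} = {})"

text \<open>M is a maximum matching of the graph whose edge set is A.\<close>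
definition max_matching :: "('v,'e) mgraph \<Rightarrow> 'e set \<Rightarrow> 'e set \<Rightarrow> bool" where
  "max_matching G A M \<longleftrightarrow> M \<subseteq> A \<and> matching G M \<and>
     (\<forall>M'. M' \<subseteq> A \<and> matching G M' \<longrightarrow> card M' \<le> card M)"

subsection \<open>Smoothing\<close>

definition inc :: "('v,'e) mgraph \<Rightarrow> 'v \<Rightarrow> 'e set" where
  "inc G x = {e\<in>edges G. incident G e x}"

definition other :: "('v,'e) mgraph \<Rightarrow> 'e \<Rightarrow> 'v \<Rightarrow> 'v" where
  "other G e x = (if fst (ends G e) = x then snd (ends G e) else fst (ends G e))"

text \<open>Smoothing a vertex x of degree 2: remove x and its two edges, join the two
  neighbours by a new edge named n (n must be fresh).\<close>
definition smooth_vertex :: "('v,'e) mgraph \<Rightarrow> 'v \<Rightarrow> 'e \<Rightarrow> ('v,'e) mgraph" where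
  "smooth_vertex G x n =
     (let f = (SOME f. f \<in> inc G x); g = (SOME g. g \<in> inc G x - {f}) in
      \<lparr>verts = verts G - {x}, edges = (edges G - inc G x) \<union> {n},
       ends = (ends G)(n := (other G f x, other G g x))\<rparr>)"

text \<open>G ~ e: delete e and smooth both of its (now degree-2) ends; n1, n2 are fresh names.\<close>
definition smooth_edge :: "('v,'e) mgraph \<Rightarrow> 'e \<Rightarrow> 'e \<Rightarrow> 'e \<Rightarrow> ('v,'e) mgraph" where
  "smooth_edge G e n1 n2 =
     smooth_vertex (smooth_vertex (G\<lparr>edges := edges G - {e}\<rparr>) (fst (ends G e)) n1)
                   (snd (ends G e)) n2"

text \<open>Lift edge names to 'e + nat, so that fresh names Inr k are available.\<close>
definition lift :: "('v,'e) mgraph \<Rightarrow> ('v, 'e + nat) mgraph" where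
  "lift G = \<lparr>verts = verts G, edges = Inl ` edges G,
             ends = (\<lambda>e. case e of Inl e' \<Rightarrow> ends G e' | Inr _ \<Rightarrow> undefined)\<rparr>"

text \<open>G ~ a ~ c; edges of G are identified with Inl-edges; the edges not of the form
  Inl e (e an edge of G) are the new edges arising from smoothing.\<close>
definition smooth2 :: "('v,'e) mgraph \<Rightarrow> 'e \<Rightarrow> 'e \<Rightarrow> ('v, 'e + nat) mgraph" where
  "smooth2 G a c = smooth_edge (smooth_edge (lift G) (Inl a) (Inr 0) (Inr 1)) (Inl c) (Inr 2) (Inr 3)"

end

theory Submission
  imports Defs
begin

text \<open>
  Let \<open>S = {x1, y1, y2, x2}\<close>. Since \<open>N1 - x1\<close>, \<open>N2 - x2\<close>, \<open>W - {y1, y2}\<close> are paths with an even number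
  of vertices, \<open>M\<close> covers every vertex outside \<open>S\<close>, so \<open>H = (E(F) - {a, c}) \<union> M\<close> is 2-regular off \<open>S\<close>.
  The two smooth orientations turn \<open>H\<close> and \<open>C\<close> into unit flows \<open>A\<close> and \<open>B\<close>; put \<open>\<phi>1 = A + 2 B\<close> and
  \<open>\<phi>2 = 2 A - B\<close>. Both vanish only on \<open>a = x1 y1\<close> and \<open>c = y2 x2\<close>. Orient the edges by the signs of
  \<open>\<phi>1\<close> and \<open>\<phi>2\<close>, respectively, and, if \<open>B\<close> runs from \<open>y1\<close> to \<open>y2\<close> along \<open>b\<close>, direct \<open>a\<close> towards \<open>x1\<close>
  and \<open>c\<close> towards \<open>y2\<close> in both.

  If \<open>e\<close> is not deletable, some cut has \<open>e\<close> leaving and everything else entering, so \<open>e\<close> carries as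
  much flow as the rest of the cut. This is impossible for \<open>a\<close> and \<open>c\<close>. An edge without ends in \<open>S\<close> has
  value 1 in one of the two flows; the cut then has at most two edges besides \<open>a\<close> and \<open>c\<close> and yields
  a cycle-separating cut of at most two edges in \<open>G \<sim> a \<sim> c\<close>. For the seven edges of \<open>C\<close> meeting \<open>S\<close>, the
  directions of \<open>a\<close> and \<open>c\<close> force the cut in one of the orientations to have at most three edges in \<open>G\<close>,
  hence to be the star of a vertex. The only star not excluded at once is that of a neighbour of \<open>x1\<close>
  or \<open>x2\<close> on \<open>N1\<close> or \<open>N2\<close>, but there, as the two smooth orientations agree on \<open>Z\<close>, the edge
  of \<open>M\<close> has \<open>\<phi>1\<close>-value 3, too much for the cut.
\<close>

section \<open>Degrees, circuits and cuts\<close>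

abbreviation src where "src G e \<equiv> fst (ends G e)"
abbreviation tgt where "tgt G e \<equiv> snd (ends G e)"

section \<open>Degree counting\<close>

lemma degE_as_sum:
  assumes "finite D"
  shows "degE G D v = (\<Sum>e\<in>D. of_bool (src G e = v) + of_bool (tgt G e = v))"
  using assms by (simp add: degE_def sum.distrib Int_def)

lemma sum_fibres:
  fixes f :: "'e \<Rightarrow> 'v" and h :: "'e \<Rightarrow> 'b::comm_monoid_add"
  assumes "finite D" "finite X"
  shows "(\<Sum>v\<in>X. \<Sum>e\<in>{e\<in>D. f e = v}. h e) = (\<Sum>e\<in>{e\<in>D. f e \<in> X}. h e)"
proof -
  have "(\<Sum>v\<in>X. \<Sum>e\<in>{e\<in>D. f e = v}. h e) = (\<Sum>v\<in>X. \<Sum>e\<in>{e\<in>{e\<in>D. f e \<in> X}. f e = v}. h e)"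
    by (rule sum.cong) (auto intro!: sum.cong)
  also have "\<dots> = (\<Sum>e\<in>{e\<in>D. f e \<in> X}. h e)"
    using assms by (intro sum.group) auto
  finally show ?thesis .
qed

lemma sum_degE:
  assumes "finite D" "finite X"
  shows "(\<Sum>v\<in>X. degE G D v) = card {e\<in>D. src G e \<in> X} + card {e\<in>D. tgt G e \<in> X}"
  unfolding degE_def sum.distrib
  using sum_fibres[OF assms, where f = "src G" and h = "\<lambda>_. 1::nat"]
    sum_fibres[OF assms, where f = "tgt G" and h = "\<lambda>_. 1::nat"]
  by simp

lemma finite_vset: "finite D \<Longrightarrow> finite (vset G D)"
  by (auto simp: vset_def)

lemma degE_pos_iff:
  assumes "finite D"
  shows "degE G D v > 0 \<longleftrightarrow> v \<in> vset G D"
  using assms by (auto simp: degE_def vset_def card_gt_0_iff)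

text \<open>\<open>degE\<close> adds two counts, each monotone in the edge set; equal totals force
  both fibres over \<open>v\<close> to agree.\<close>

lemma incident_mem_of_degE_eq:
  assumes "finite S" "D \<subseteq> S" "degE G D v = degE G S v" "e \<in> S" "incident G e v"
  shows "e \<in> D"
proof -
  have 1: "card {e\<in>D. src G e = v} \<le> card {e\<in>S. src G e = v}"
    and 2: "card {e\<in>D. tgt G e = v} \<le> card {e\<in>S. tgt G e = v}"
    using assms by (auto intro!: card_mono)
  have "{e\<in>D. src G e = v} = {e\<in>S. src G e = v}"
    using assms 1 2 by (intro card_subset_eq) (auto simp: degE_def)
  moreover have "{e\<in>D. tgt G e = v} = {e\<in>S. tgt G e = v}"
    using assms 1 2 by (intro card_subset_eq) (auto simp: degE_def)
  ultimately show ?thesis using assms(4,5) unfolding incident_def by blast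
qed

lemma degE_closed:
  assumes "D \<subseteq> S" "\<And>e. e \<in> S \<Longrightarrow> incident G e v \<Longrightarrow> e \<in> D"
  shows "degE G D v = degE G S v"
proof -
  have "{e\<in>D. src G e = v} = {e\<in>S. src G e = v}" "{e\<in>D. tgt G e = v} = {e\<in>S. tgt G e = v}"
    using assms by (auto simp: incident_def)
  then show ?thesis by (simp add: degE_def)
qed

section \<open>Components of 2-regular edge sets\<close>

lemma sym_adjrel: "sym (adjrel G D)"
  by (auto simp: sym_def adjrel_def joins_def)

lemma adjrel_memI: "e \<in> D \<Longrightarrow> (src G e, tgt G e) \<in> adjrel G D" "e \<in> D \<Longrightarrow> (tgt G e, src G e) \<in> adjrel G D"
  by (force simp: adjrel_def joins_def)+

lemma adjrel_rtrancl_swap: "(u, v) \<in> (adjrel G D)\<^sup>* \<Longrightarrow> (v, u) \<in> (adjrel G D)\<^sup>*"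
  using sym_adjrel sym_rtrancl symD by metis

lemma adjrel_ends_iff:
  assumes "e \<in> D"
  shows "(u, src G e) \<in> (adjrel G D)\<^sup>* \<longleftrightarrow> (u, tgt G e) \<in> (adjrel G D)\<^sup>*"
proof
  show "(u, tgt G e) \<in> (adjrel G D)\<^sup>*" if "(u, src G e) \<in> (adjrel G D)\<^sup>*"
    using rtrancl.rtrancl_into_rtrancl[OF that adjrel_memI(1)[OF assms]] .
  show "(u, src G e) \<in> (adjrel G D)\<^sup>*" if "(u, tgt G e) \<in> (adjrel G D)\<^sup>*"
    using rtrancl.rtrancl_into_rtrancl[OF that adjrel_memI(2)[OF assms]] .
qed

text \<open>Testing one end is enough: the two ends of an edge of \<open>S\<close> are reachable
  from \<open>u\<close> together (\<open>adjrel_ends_iff\<close>).\<close>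

definition comp_edges :: "('v,'e) mgraph \<Rightarrow> 'e set \<Rightarrow> 'v \<Rightarrow> 'e set" where
  "comp_edges G S u = {e\<in>S. (u, src G e) \<in> (adjrel G S)\<^sup>*}"

lemma comp_edges_closed:
  assumes "e \<in> S" "incident G e v" "v \<in> vset G (comp_edges G S u)"
  shows "e \<in> comp_edges G S u"
proof -
  have "(u, v) \<in> (adjrel G S)\<^sup>*"
    using assms(3) adjrel_ends_iff[of _ S u G] by (auto simp: vset_def comp_edges_def)
  then show ?thesis
    using assms(1,2) adjrel_ends_iff[of e S u G] by (auto simp: incident_def comp_edges_def)
qed

lemma comp_edges_reach:
  assumes "(u, v) \<in> (adjrel G S)\<^sup>*"
  shows "(u, v) \<in> (adjrel G (comp_edges G S u))\<^sup>*"
  using assms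
proof (induction rule: rtrancl_induct)
  case (step p q)
  then obtain e where e: "e \<in> S" "joins G e p q" by (auto simp: adjrel_def)
  have "(u, src G e) \<in> (adjrel G S)\<^sup>*"
    using e step(1,2) by (auto simp: joins_def intro: rtrancl.rtrancl_into_rtrancl)
  then have "e \<in> comp_edges G S u" using e by (simp add: comp_edges_def)
  then have "(p, q) \<in> adjrel G (comp_edges G S u)" using e by (auto simp: adjrel_def)
  then show ?case by (rule rtrancl.rtrancl_into_rtrancl[OF step(3)])
qed simp

text \<open>The component of \<open>u\<close> contains every edge of \<open>S\<close> at each of its
  vertices, so it inherits degree 2, and it is connected through \<open>u\<close>. This splits a
  2-regular edge set into circuits.\<close>

lemma comp_edges_circuit:
  assumes "finite S" "S \<subseteq> edges G" "\<forall>v\<in>vset G S. degE G S v = 2" "u \<in> vset G S"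
  shows "circuit G (comp_edges G S u)" "u \<in> vset G (comp_edges G S u)"
proof -
  let ?D = "comp_edges G S u"
  obtain e where e: "e \<in> S" "incident G e u" using assms(4) by (auto simp: vset_def incident_def)
  have "e \<in> ?D" using e adjrel_ends_iff[of e S u G] by (auto simp: comp_edges_def incident_def)
  then show uv: "u \<in> vset G ?D" using e by (auto simp: vset_def incident_def)
  have sub: "?D \<subseteq> S" by (auto simp: comp_edges_def)
  have "degE G ?D v = 2" if "v \<in> vset G ?D" for v
  proof -
    have "degE G ?D v = degE G S v"
      by (rule degE_closed[OF sub]) (rule comp_edges_closed[OF _ _ that])
    moreover have "v \<in> vset G S" using that sub by (auto simp: vset_def)
    ultimately show ?thesis using assms(3) by simp
  qed
  moreover have "(u, v) \<in> (adjrel G ?D)\<^sup>*" if "v \<in> vset G ?D" for v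
  proof -
    have "(u, v) \<in> (adjrel G S)\<^sup>*"
      using that adjrel_ends_iff[of _ S u G] by (auto simp: vset_def comp_edges_def)
    then show ?thesis by (rule comp_edges_reach)
  qed
  then have "(v, w) \<in> (adjrel G ?D)\<^sup>*" if "v \<in> vset G ?D" "w \<in> vset G ?D" for v w
    using that adjrel_rtrancl_swap by (metis rtrancl_trans)
  ultimately show "circuit G ?D"
    unfolding circuit_def using \<open>e \<in> ?D\<close> sub assms(2) by blast
qed

text \<open>At \<open>v\<close> the circuit already uses up the whole degree 2 of \<open>S\<close>,
  so no edge of \<open>S\<close> at \<open>v\<close> is left outside \<open>D\<close>.\<close>

lemma circuit_absorbs:
  assumes "finite S" "\<forall>v\<in>vset G S. degE G S v = 2" "circuit G D" "D \<subseteq> S"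
    "v \<in> vset G D" "e \<in> S" "incident G e v"
  shows "e \<in> D"
proof -
  have "v \<in> vset G S" using assms(4,5) by (auto simp: vset_def)
  then have "degE G D v = degE G S v" using assms by (auto simp: circuit_def)
  then show ?thesis using incident_mem_of_degE_eq[OF assms(1,4) _ assms(6,7)] by blast
qed

text \<open>A walk in \<open>D'\<close> from the common vertex never leaves \<open>D\<close>,
  because \<open>D\<close> absorbs each edge met on the way.\<close>

lemma circuit_subset_if_meet:
  assumes "finite S" "\<forall>v\<in>vset G S. degE G S v = 2" "circuit G D" "D \<subseteq> S"
    "circuit G D'" "D' \<subseteq> S" "v \<in> vset G D" "v \<in> vset G D'"
  shows "D' \<subseteq> D"
proof
  have *: "w \<in> vset G D" if "(v, w) \<in> (adjrel G D')\<^sup>*" for w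
    using that
  proof (induction rule: rtrancl_induct)
    case (step p q)
    then obtain e where e: "e \<in> D'" "joins G e p q" by (auto simp: adjrel_def)
    then have "e \<in> D" using circuit_absorbs[OF assms(1-4) step(3)] assms(6)
      by (auto simp: joins_def incident_def)
    then show ?case using e by (auto simp: joins_def vset_def intro!: bexI[of _ e])
  qed (rule assms)
  fix e assume e: "e \<in> D'"
  then have "src G e \<in> vset G D'" by (auto simp: vset_def)
  then have "src G e \<in> vset G D" using * assms(5,8) by (auto simp: circuit_def)
  then show "e \<in> D" using circuit_absorbs[OF assms(1-4)] e assms(6) by (auto simp: incident_def)
qed

lemma circuit_eq_if_meet:
  assumes "finite S" "\<forall>v\<in>vset G S. degE G S v = 2" "circuit G D" "D \<subseteq> S"
    "circuit G D'" "D' \<subseteq> S" "v \<in> vset G D" "v \<in> vset G D'"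
  shows "D = D'"
  using circuit_subset_if_meet[OF assms] circuit_subset_if_meet[OF assms(1,2,5,6,3,4,8,7)] by blast

section \<open>Circuits, acyclic vertex sets and cut sizes\<close>

lemma sum_degE_vset:
  assumes "finite D"
  shows "(\<Sum>v\<in>vset G D. degE G D v) = 2 * card D"
proof -
  have "{e\<in>D. src G e \<in> vset G D} = D" "{e\<in>D. tgt G e \<in> vset G D} = D"
    by (auto simp: vset_def)
  then show ?thesis using sum_degE[OF assms finite_vset[OF assms], of G G] by simp
qed

text \<open>Edges are discarded as long as the set stays nonempty and the inequality survives. When
  none can be discarded, every degree is at least 2 and there are no more edges than vertices, so by
  the handshake count all degrees are exactly 2 and any component is a circuit.\<close>

lemma ex_circuit:
  assumes "finite E" "E \<subseteq> edges G" "E \<noteq> {}" "card (vset G E) \<le> card E"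
  shows "\<exists>D\<subseteq>E. circuit G D"
  using assms
proof (induction "card E" arbitrary: E rule: less_induct)
  case less
  note fin = less.prems(1)
  show ?case
  proof (cases "\<exists>e\<in>E. E - {e} \<noteq> {} \<and> card (vset G (E - {e})) \<le> card (E - {e})")
    case True
    then obtain e where e: "e \<in> E" "E - {e} \<noteq> {}" "card (vset G (E - {e})) \<le> card (E - {e})" by blast
    have "\<exists>D\<subseteq>E - {e}. circuit G D"
      by (rule less.hyps[OF card_Diff1_less[OF fin e(1)]]) (use e less.prems in auto)
    then show ?thesis by blast
  next
    case False
    have mono: "card (vset G (E - {e})) \<le> card (vset G E)" for e
      by (rule card_mono) (auto simp: vset_def fin)
    have deg: "degE G E v \<ge> 2" if v: "v \<in> vset G E" for v
    proof (rule ccontr)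
      assume "\<not> ?thesis"
      \<comment> \<open>Deleting the only edge at a vertex of degree 1 loses the vertex too, so the
        inequality would survive; the remaining possibility \<open>E = {e}\<close>, with two
        distinct ends, violates it.\<close>
      then have d: "degE G E v = 1" using degE_pos_iff[OF fin, of G v] v by simp
      obtain e where e: "e \<in> E" "incident G e v" using v by (auto simp: vset_def incident_def)
      have e': "e' = e" if "e' \<in> E" "incident G e' v" for e'
      proof (rule ccontr)
        assume "e' \<noteq> e"
        then have "(\<Sum>k\<in>{e, e'}. of_bool (src G k = v) + of_bool (tgt G k = v)) \<ge> (2::nat)"
          using e(2) that(2) by (auto simp: incident_def)
        also have "(\<Sum>k\<in>{e, e'}. of_bool (src G k = v) + of_bool (tgt G k = v)) \<le> degE G E v"
          unfolding degE_as_sum[OF fin] using e that fin by (intro sum_mono2) auto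
        finally show False using d by simp
      qed
      have ne: "src G e \<noteq> tgt G e"
      proof
        assume "src G e = tgt G e"
        then have "(\<Sum>k\<in>{e}. of_bool (src G k = v) + of_bool (tgt G k = v)) \<ge> (2::nat)"
          using e by (auto simp: incident_def)
        also have "(\<Sum>k\<in>{e}. of_bool (src G k = v) + of_bool (tgt G k = v)) \<le> degE G E v"
          unfolding degE_as_sum[OF fin] using e fin by (intro sum_mono2) auto
        finally show False using d by simp
      qed
      have "vset G (E - {e}) \<subseteq> vset G E - {v}"
        using e' by (auto simp: vset_def incident_def)
      then have "card (vset G (E - {e})) \<le> card (vset G E - {v})"
        by (intro card_mono) (auto simp: fin finite_vset)
      also have "\<dots> = card (vset G E) - 1" using v by simp
      also have "\<dots> \<le> card (E - {e})" using less.prems(4) e by simp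
      finally have "E - {e} = {}" using False e by blast
      then have "E = {e}" using e by blast
      then show False using less.prems(4) ne by (simp add: vset_def)
    qed
    have le: "card E \<le> card (vset G E)"
    proof (rule ccontr)
      assume c: "\<not> ?thesis"
      obtain e where e: "e \<in> E" using less.prems by blast
      have "card (vset G E) \<ge> 1" using e fin finite_vset[OF fin, of G]
        by (auto simp: vset_def Suc_le_eq card_gt_0_iff)
      then have "E - {e} \<noteq> {}" using c e fin by (metis Diff_eq_empty_iff One_nat_def card.empty card.insert empty_iff finite.emptyI not_le order_refl subset_singletonD)
      moreover have "card (vset G (E - {e})) \<le> card (E - {e})"
        using mono[of e] c e fin by simp
      ultimately show False using False e by blast
    qed
    have deg2: "degE G E v = 2" if v: "v \<in> vset G E" for v
    proof (rule ccontr)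
      assume "degE G E v \<noteq> 2"
      then have "(\<Sum>v\<in>vset G E. 2) < (\<Sum>v\<in>vset G E. degE G E v)"
        using deg v by (intro sum_strict_mono_ex1) (auto simp: fin finite_vset intro!: bexI[of _ v] le_neq_implies_less)
      then show False using le sum_degE_vset[OF fin, of G] by simp
    qed
    obtain e where "e \<in> E" using less.prems by blast
    then have "src G e \<in> vset G E" by (auto simp: vset_def)
    from comp_edges_circuit(1)[OF fin less.prems(2) _ this] deg2
    show ?thesis by (intro exI[of _ "comp_edges G E (src G e)"]) (auto simp: comp_edges_def)
  qed
qed

lemma cut_compl:
  assumes "wf_graph G"
  shows "cut G (verts G - X) = cut G X"
  using assms by (auto simp: cut_def wf_graph_def)

text \<open>By \<open>ex_circuit\<close>, an acyclic set of \<open>n\<close> vertices spans at most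
  \<open>n - 1\<close> edges; of its \<open>3 * n\<close> edge ends in a cubic graph at least
  \<open>n + 2\<close> are left for the cut.\<close>

lemma acyclic_cut_ge:
  assumes "cubic G" "X \<subseteq> verts G" "X \<noteq> {}" "\<not> has_cycle_in G X"
  shows "card X + 2 \<le> card (cut G X)"
proof -
  define I where "I = {e\<in>edges G. src G e \<in> X \<and> tgt G e \<in> X}"
  have wf: "finite (edges G)" "finite (verts G)" using assms(1) by (auto simp: cubic_def wf_graph_def)
  have fX: "finite X" using wf assms(2) finite_subset by blast
  have "3 * card X = (\<Sum>v\<in>X. degE G (edges G) v)"
    using assms(1,2) by (simp add: cubic_def subset_eq)
  also have "\<dots> = card {e\<in>edges G. src G e \<in> X} + card {e\<in>edges G. tgt G e \<in> X}"
    by (rule sum_degE[OF wf(1) fX])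
  also have "{e\<in>edges G. src G e \<in> X} = I \<union> {e\<in>edges G. src G e \<in> X \<and> tgt G e \<notin> X}"
    by (auto simp: I_def)
  also have "card \<dots> = card I + card {e\<in>edges G. src G e \<in> X \<and> tgt G e \<notin> X}"
    by (rule card_Un_disjoint) (auto simp: I_def wf)
  also have "{e\<in>edges G. tgt G e \<in> X} = I \<union> {e\<in>edges G. src G e \<notin> X \<and> tgt G e \<in> X}"
    by (auto simp: I_def)
  also have "card \<dots> = card I + card {e\<in>edges G. src G e \<notin> X \<and> tgt G e \<in> X}"
    by (rule card_Un_disjoint) (auto simp: I_def wf)
  finally have *: "3 * card X = 2 * card I + (card {e\<in>edges G. src G e \<in> X \<and> tgt G e \<notin> X}
      + card {e\<in>edges G. src G e \<notin> X \<and> tgt G e \<in> X})" by simp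
  have "cut G X = {e\<in>edges G. src G e \<in> X \<and> tgt G e \<notin> X} \<union> {e\<in>edges G. src G e \<notin> X \<and> tgt G e \<in> X}"
    by (auto simp: cut_def)
  also have "card \<dots> = card {e\<in>edges G. src G e \<in> X \<and> tgt G e \<notin> X}
      + card {e\<in>edges G. src G e \<notin> X \<and> tgt G e \<in> X}"
    by (rule card_Un_disjoint) (auto simp: wf)
  finally have **: "3 * card X = 2 * card I + card (cut G X)" using * by simp
  have "card X > 0" using assms(3) fX by (simp add: card_gt_0_iff)
  moreover have "card I < card X"
  proof (cases "I = {}")
    case False
    have sub: "vset G I \<subseteq> X" by (auto simp: vset_def I_def)
    have "\<not> card (vset G I) \<le> card I"
    proof
      assume "card (vset G I) \<le> card I"
      then obtain D where "D \<subseteq> I" "circuit G D"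
        using ex_circuit[of I G] False wf by (auto simp: I_def)
      moreover have "vset G D \<subseteq> X" using \<open>D \<subseteq> I\<close> sub by (auto simp: vset_def)
      ultimately show False using assms(4) by (auto simp: has_cycle_in_def)
    qed
    then show ?thesis using card_mono[OF fX sub] by simp
  qed (use \<open>card X > 0\<close> in simp)
  ultimately show ?thesis using ** by linarith
qed

lemma cyc_conn_cut:
  assumes "cubic G" "cyc_edge_conn G k" "X \<subseteq> verts G" "X \<noteq> {}" "X \<noteq> verts G" "card (cut G X) < k"
  obtains Y where "Y = X \<or> Y = verts G - X" "card Y + 2 \<le> card (cut G X)" "Y \<noteq> {}" "finite Y"
proof -
  have wf: "wf_graph G" using assms(1) by (simp add: cubic_def)
  have "\<not> cycle_separating G X" using assms(2,6) by (auto simp: cyc_edge_conn_def)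
  then have "\<not> has_cycle_in G X \<or> \<not> has_cycle_in G (verts G - X)"
    using assms(3) by (simp add: cycle_separating_def)
  then obtain Y where Y: "Y = X \<or> Y = verts G - X" "\<not> has_cycle_in G Y" by blast
  then have "Y \<noteq> {}" "Y \<subseteq> verts G" using assms(3-5) by auto
  moreover have "cut G Y = cut G X" using Y(1) cut_compl[OF wf] by auto
  ultimately show ?thesis using that[OF Y(1)] acyclic_cut_ge[OF assms(1) _ _ Y(2)] wf
    by (auto simp: wf_graph_def intro: finite_subset)
qed

section \<open>Flows and deletable edges\<close>

text \<open>Values refer to the reference direction of \<open>ends\<close>; a negative value is flow
  running the other way, so no orientation enters the notion.\<close>

definition is_flow :: "('v,'e) mgraph \<Rightarrow> ('e \<Rightarrow> int) \<Rightarrow> bool" where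
  "is_flow G \<phi> \<longleftrightarrow> (\<forall>v\<in>verts G.
     (\<Sum>e\<in>{e\<in>edges G. src G e = v}. \<phi> e) = (\<Sum>e\<in>{e\<in>edges G. tgt G e = v}. \<phi> e))"

lemma is_flow_lincomb:
  assumes "is_flow G \<phi>" "is_flow G \<psi>"
  shows "is_flow G (\<lambda>e. k * \<phi> e + l * \<psi> e)"
  using assms by (simp add: is_flow_def sum.distrib flip: sum_distrib_left)

text \<open>Conservation is summed over \<open>X\<close>; edges with both ends in \<open>X\<close>
  occur on both sides and cancel, leaving the signed cut.\<close>

lemma flow_cut:
  assumes "wf_graph G" "is_flow G \<phi>" "X \<subseteq> verts G"
  shows "(\<Sum>e\<in>cut G X. if src G e \<in> X then \<phi> e else - \<phi> e) = 0"
proof -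
  define P where "P = {e\<in>edges G. src G e \<in> X}"
  define Q where "Q = {e\<in>edges G. tgt G e \<in> X}"
  have fin: "finite (edges G)" "finite X" using assms(1,3) by (auto simp: wf_graph_def intro: finite_subset)
  then have fPQ: "finite P" "finite Q" by (auto simp: P_def Q_def)
  have "sum \<phi> P = (\<Sum>v\<in>X. \<Sum>e\<in>{e\<in>edges G. src G e = v}. \<phi> e)"
    unfolding P_def by (rule sum_fibres[OF fin, symmetric])
  also have "\<dots> = (\<Sum>v\<in>X. \<Sum>e\<in>{e\<in>edges G. tgt G e = v}. \<phi> e)"
    using assms(2,3) by (intro sum.cong[OF refl]) (auto simp: is_flow_def)
  also have "\<dots> = sum \<phi> Q"
    unfolding Q_def by (rule sum_fibres[OF fin])
  finally have "sum \<phi> P = sum \<phi> Q" .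
  moreover have "sum \<phi> P = sum \<phi> (P \<inter> Q) + sum \<phi> (P - Q)" "sum \<phi> Q = sum \<phi> (Q \<inter> P) + sum \<phi> (Q - P)"
    using sum.Int_Diff fPQ by blast+
  ultimately have eq: "sum \<phi> (P - Q) = sum \<phi> (Q - P)" by (simp add: Int_commute)
  have "cut G X = (P - Q) \<union> (Q - P)" by (auto simp: cut_def P_def Q_def)
  also have "(\<Sum>e\<in>\<dots>. if src G e \<in> X then \<phi> e else - \<phi> e)
      = (\<Sum>e\<in>P - Q. if src G e \<in> X then \<phi> e else - \<phi> e) + (\<Sum>e\<in>Q - P. if src G e \<in> X then \<phi> e else - \<phi> e)"
    using fPQ by (intro sum.union_disjoint) auto
  also have "(\<Sum>e\<in>P - Q. if src G e \<in> X then \<phi> e else - \<phi> e) = sum \<phi> (P - Q)"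
    by (rule sum.cong) (auto simp: P_def)
  also have "(\<Sum>e\<in>Q - P. if src G e \<in> X then \<phi> e else - \<phi> e) = (\<Sum>e\<in>Q - P. - \<phi> e)"
    by (rule sum.cong) (auto simp: P_def Q_def)
  finally show ?thesis using eq by (simp add: sum_negf)
qed

lemma not_strong_closed:
  assumes "wf_graph G" "\<not> strong G ori"
  obtains X where "X \<subseteq> verts G" "X \<noteq> {}" "X \<noteq> verts G"
    "\<And>k. k \<in> edges G \<Longrightarrow> otail G ori k \<in> X \<Longrightarrow> ohead G ori k \<in> X"
proof -
  obtain u v where uv: "u \<in> verts G" "v \<in> verts G" "u \<noteq> v" "(u, v) \<notin> (arcs G ori)\<^sup>+"
    using assms(2) by (auto simp: strong_def)
  define X where "X = {w\<in>verts G. (u, w) \<in> (arcs G ori)\<^sup>*}"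
  have "u \<in> X" "v \<notin> X" using uv by (auto simp: X_def rtrancl_eq_or_trancl)
  moreover have "ohead G ori k \<in> X" if "k \<in> edges G" "otail G ori k \<in> X" for k
  proof -
    have "(otail G ori k, ohead G ori k) \<in> arcs G ori" using that(1) by (auto simp: arcs_def)
    moreover have "ohead G ori k \<in> verts G" using assms(1) that(1) by (auto simp: ohead_def wf_graph_def)
    ultimately show ?thesis using that(2) by (auto simp: X_def intro: rtrancl.rtrancl_into_rtrancl)
  qed
  ultimately show ?thesis using that[of X] uv by (auto simp: X_def)
qed

text \<open>If deleting \<open>e\<close> destroys strength, some \<open>X\<close> is left by no edge
  except possibly \<open>e\<close>. The net flow out of \<open>X\<close> is zero, so
  \<open>e\<close> carries out exactly what the other cut edges bring in. If \<open>e\<close>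
  carried nothing out, the whole cut would lie in \<open>Z\<close>, which is too small. Hence
  \<open>\<phi> e \<noteq> 0\<close>: an edge without flow is always deletable.\<close>

lemma not_deletable_cut:
  assumes wf: "wf_graph G" and e: "e \<in> edges G" "\<not> deletable G ori e" and fl: "is_flow G \<phi>"
    and ori: "\<And>k. k \<in> edges G \<Longrightarrow> \<phi> k \<noteq> 0 \<Longrightarrow> ori k \<longleftrightarrow> \<phi> k < 0"
    and Z: "{k\<in>edges G. \<phi> k = 0} \<subseteq> Z" "finite Z" "card Z \<le> 2"
    and conn: "\<And>X. X \<subseteq> verts G \<Longrightarrow> X \<noteq> {} \<Longrightarrow> X \<noteq> verts G \<Longrightarrow> 3 \<le> card (cut G X)"
  obtains X where "X \<subseteq> verts G" "X \<noteq> {}" "X \<noteq> verts G" "otail G ori e \<in> X" "ohead G ori e \<notin> X"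
    "\<And>k. k \<in> edges G \<Longrightarrow> k \<noteq> e \<Longrightarrow> otail G ori k \<in> X \<Longrightarrow> ohead G ori k \<in> X"
    "e \<in> cut G X" "\<phi> e \<noteq> 0" "(\<Sum>k\<in>cut G X - {e}. \<bar>\<phi> k\<bar>) = \<bar>\<phi> e\<bar>"
    "int (card (cut G X - Z)) \<le> \<bar>\<phi> e\<bar> + 1"
proof -
  let ?G = "G\<lparr>edges := edges G - {e}\<rparr>"
  have wf': "wf_graph ?G" using wf by (auto simp: wf_graph_def)
  have "\<not> strong ?G ori" using e by (simp add: deletable_def)
  then obtain X where X: "X \<subseteq> verts ?G" "X \<noteq> {}" "X \<noteq> verts ?G"
    and cl0: "\<And>k. k \<in> edges ?G \<Longrightarrow> otail ?G ori k \<in> X \<Longrightarrow> ohead ?G ori k \<in> X"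
    using not_strong_closed[OF wf'] by blast
  have cl: "ohead G ori k \<in> X" if "k \<in> edges G" "k \<noteq> e" "otail G ori k \<in> X" for k
    using cl0[of k] that by (cases "ori k") (simp_all add: otail_def ohead_def)
  have X: "X \<subseteq> verts G" "X \<noteq> {}" "X \<noteq> verts G" using X by simp_all
  \<comment> \<open>\<open>\<chi>\<close> measures flow out of \<open>X\<close>; cut edges other
    than \<open>e\<close> point into \<open>X\<close> unless their flow is zero, so they never count
    positively.\<close>
  define \<chi> where "\<chi> k = (if src G k \<in> X then \<phi> k else - \<phi> k)" for k
  have fin: "finite (cut G X)" using wf by (auto simp: cut_def wf_graph_def)
  have \<chi>: "\<chi> k = - \<bar>\<phi> k\<bar>" if k: "k \<in> cut G X" "k \<noteq> e" for k
  proof (cases "\<phi> k = 0")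
    case False
    have "k \<in> edges G" using k by (simp add: cut_def)
    then show ?thesis using ori[OF _ False] cl[OF _ k(2)] k False
      by (auto simp: \<chi>_def cut_def otail_def ohead_def split: if_splits)
  qed (simp add: \<chi>_def)
  have s0: "(\<Sum>k\<in>cut G X. \<chi> k) = 0" using flow_cut[OF wf fl X(1)] by (simp add: \<chi>_def)
  have small: "\<not> cut G X \<subseteq> Z"
    using conn[OF X] Z(2,3) card_mono[of Z "cut G X"] by auto
  have ecut: "e \<in> cut G X"
  proof (rule ccontr)
    assume n: "e \<notin> cut G X"
    then have "(\<Sum>k\<in>cut G X. \<chi> k) = - (\<Sum>k\<in>cut G X. \<bar>\<phi> k\<bar>)"
      unfolding sum_negf[symmetric] by (intro sum.cong refl \<chi>) auto
    then have "(\<Sum>k\<in>cut G X. \<bar>\<phi> k\<bar>) = 0" using s0 by simp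
    then have "\<forall>k\<in>cut G X. \<phi> k = 0" using fin by (subst (asm) sum_nonneg_eq_0_iff) auto
    then show False using small Z(1) by (auto simp: cut_def)
  qed
  have "(\<Sum>k\<in>cut G X. \<chi> k) = \<chi> e + (\<Sum>k\<in>cut G X - {e}. \<chi> k)"
    using fin ecut by (simp add: sum.remove)
  also have "(\<Sum>k\<in>cut G X - {e}. \<chi> k) = - (\<Sum>k\<in>cut G X - {e}. \<bar>\<phi> k\<bar>)"
    unfolding sum_negf[symmetric] by (intro sum.cong refl \<chi>) auto
  finally have \<chi>e: "\<chi> e = (\<Sum>k\<in>cut G X - {e}. \<bar>\<phi> k\<bar>)" using s0 by simp
  have pos: "\<chi> e > 0"
  proof (rule ccontr)
    assume "\<not> ?thesis"
    moreover have "(\<Sum>k\<in>cut G X - {e}. \<bar>\<phi> k\<bar>) \<ge> 0" by (rule sum_nonneg) simp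
    ultimately have z: "\<chi> e = 0" "(\<Sum>k\<in>cut G X - {e}. \<bar>\<phi> k\<bar>) = 0" using \<chi>e by auto
    from z(2) have "\<forall>k\<in>cut G X - {e}. \<phi> k = 0" using fin by (subst (asm) sum_nonneg_eq_0_iff) auto
    moreover have "\<phi> e = 0" using z(1) by (auto simp: \<chi>_def split: if_splits)
    ultimately show False using small Z(1) by (auto simp: cut_def)
  qed
  then have ne: "\<phi> e \<noteq> 0" and abs: "\<chi> e = \<bar>\<phi> e\<bar>" by (auto simp: \<chi>_def split: if_splits)
  have out: "otail G ori e \<in> X" "ohead G ori e \<notin> X"
    using pos ori[OF e(1) ne] ecut
    by (auto simp: \<chi>_def cut_def otail_def ohead_def split: if_splits)
  \<comment> \<open>Outside \<open>Z\<close> the integer flow is at least 1 in absolute value, so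
    the flow through \<open>e\<close> bounds the number of further cut edges there.\<close>
  have "int (card (cut G X - Z - {e})) = (\<Sum>k\<in>cut G X - Z - {e}. 1)" by simp
  also have "\<dots> \<le> (\<Sum>k\<in>cut G X - Z - {e}. \<bar>\<phi> k\<bar>)"
  proof (rule sum_mono)
    fix k assume "k \<in> cut G X - Z - {e}"
    then have "\<phi> k \<noteq> 0" using Z(1) by (auto simp: cut_def)
    then show "1 \<le> \<bar>\<phi> k\<bar>" by linarith
  qed
  also have "\<dots> \<le> (\<Sum>k\<in>cut G X - {e}. \<bar>\<phi> k\<bar>)" using fin by (intro sum_mono2) auto
  finally have "int (card (cut G X - Z - {e})) \<le> \<bar>\<phi> e\<bar>" using \<chi>e abs by simp
  moreover have "card (cut G X - Z) \<le> card (cut G X - Z - {e}) + 1"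
    using fin card_Diff1_le[of "cut G X - Z" e] by (cases "e \<in> cut G X - Z") auto
  ultimately have "int (card (cut G X - Z)) \<le> \<bar>\<phi> e\<bar> + 1" by linarith
  then show ?thesis using that[OF X out cl ecut ne] \<chi>e abs by simp
qed

section \<open>Flows from smooth orientations\<close>

lemma smooth_orient_in_out:
  assumes "finite S" "S \<subseteq> edges G" "\<forall>v\<in>vset G S. degE G S v = 2"
    "smooth_orient G ori S" "v \<in> vset G S"
  shows "card {e\<in>S. ohead G ori e = v} = 1" "card {e\<in>S. otail G ori e = v} = 1"
proof -
  let ?D = "comp_edges G S v"
  have D: "circuit G ?D" "v \<in> vset G ?D" "?D \<subseteq> S"
    using comp_edges_circuit[OF assms(1-3,5)] by (auto simp: comp_edges_def)
  \<comment> \<open>All edges of \<open>S\<close> at \<open>v\<close> lie in its component, so in-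
    and out-degree can be read off one circuit.\<close>
  have "{e\<in>S. ohead G ori e = v} = {e\<in>?D. ohead G ori e = v}"
    "{e\<in>S. otail G ori e = v} = {e\<in>?D. otail G ori e = v}"
    using circuit_absorbs[OF assms(1,3) D(1,3,2)] D(3)
    by (auto simp: ohead_def otail_def incident_def split: if_splits)
  then show "card {e\<in>S. ohead G ori e = v} = 1" "card {e\<in>S. otail G ori e = v} = 1"
    using assms(4) D by (auto simp: smooth_orient_def)
qed

definition unit_flow :: "('e \<Rightarrow> bool) \<Rightarrow> 'e set \<Rightarrow> 'e \<Rightarrow> int" where
  "unit_flow ori S e = (if e \<in> S then if ori e then -1 else 1 else 0)"

text \<open>An edge reversed by \<open>ori\<close> has value -1 and its ends swapped, so the balance
  in reference directions is out-degree minus in-degree of \<open>ori\<close> within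
  \<open>S\<close>, which is 0.\<close>

lemma unit_flow_is_flow:
  assumes "finite (edges G)" "S \<subseteq> edges G" "\<forall>v\<in>vset G S. degE G S v = 2" "smooth_orient G ori S"
  shows "is_flow G (unit_flow ori S)"
  unfolding is_flow_def
proof
  fix v assume "v \<in> verts G"
  have fS: "finite S" using assms(1,2) finite_subset by blast
  have part: "(\<Sum>e\<in>{e\<in>edges G. f e = v}. unit_flow ori S e)
      = (\<Sum>e\<in>S. of_bool (f e = v) * (if ori e then -1 else 1))" for f
  proof -
    have "(\<Sum>e\<in>{e\<in>edges G. f e = v}. unit_flow ori S e) = (\<Sum>e\<in>{e\<in>S. f e = v}. unit_flow ori S e)"
      using assms(1,2) by (intro sum.mono_neutral_right) (auto simp: unit_flow_def)
    also have "\<dots> = (\<Sum>e\<in>S. if f e = v then unit_flow ori S e else 0)"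
      using fS by (simp add: sum.inter_filter)
    also have "\<dots> = (\<Sum>e\<in>S. of_bool (f e = v) * (if ori e then -1 else 1))"
      by (rule sum.cong) (auto simp: unit_flow_def)
    finally show ?thesis .
  qed
  have "card {e\<in>S. ohead G ori e = v} = card {e\<in>S. otail G ori e = v}"
  proof (cases "v \<in> vset G S")
    case True
    then show ?thesis using smooth_orient_in_out[OF fS assms(2-4)] by simp
  next
    case False
    then have "{e\<in>S. ohead G ori e = v} = {}" "{e\<in>S. otail G ori e = v} = {}"
      by (auto simp: vset_def ohead_def otail_def)
    then show ?thesis by (simp only:)
  qed
  then have "(\<Sum>e\<in>S. of_bool (ohead G ori e = v) :: int) = (\<Sum>e\<in>S. of_bool (otail G ori e = v))"
    using fS by (simp add: Int_def)
  then have "(\<Sum>e\<in>S. of_bool (otail G ori e = v) - of_bool (ohead G ori e = v) :: int) = 0"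
    by (simp add: sum_subtractf)
  also have "(\<Sum>e\<in>S. of_bool (otail G ori e = v) - of_bool (ohead G ori e = v) :: int)
     = (\<Sum>e\<in>S. of_bool (src G e = v) * (if ori e then -1 else 1) - of_bool (tgt G e = v) * (if ori e then -1 else 1))"
    by (rule sum.cong) (simp_all add: otail_def ohead_def)
  finally show "(\<Sum>e\<in>{e\<in>edges G. src G e = v}. unit_flow ori S e) = (\<Sum>e\<in>{e\<in>edges G. tgt G e = v}. unit_flow ori S e)"
    unfolding part by (simp add: sum_subtractf)
qed

section \<open>A single orientation is never enough\<close>

lemma not_strong_isolated:
  assumes "v \<in> verts G" "w \<in> verts G" "v \<noteq> w"
    "(\<forall>e\<in>edges G. otail G ori e \<noteq> v) \<or> (\<forall>e\<in>edges G. ohead G ori e \<noteq> v)"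
  shows "\<not> strong G ori"
proof
  assume "strong G ori"
  then have "(v, w) \<in> (arcs G ori)\<^sup>+" "(w, v) \<in> (arcs G ori)\<^sup>+" using assms(1-3) by (auto simp: strong_def)
  then have "\<exists>y. (v, y) \<in> arcs G ori" "\<exists>y. (y, v) \<in> arcs G ori"
    by (meson tranclD, meson tranclD2)
  then show False using assms(4) by (auto simp: arcs_def)
qed

text \<open>At a vertex of degree 3, at most one edge points one of the two ways.\<close>
lemma ex_not_deletable:
  assumes "cubic G" "v \<in> verts G" "w \<in> verts G" "v \<noteq> w"
  obtains e where "e \<in> edges G" "\<not> deletable G ori e"
proof -
  have fin: "finite (edges G)" using assms(1) by (simp add: cubic_def wf_graph_def)
  let ?Out = "{e\<in>edges G. otail G ori e = v}" and ?In = "{e\<in>edges G. ohead G ori e = v}"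
  have "card ?Out + card ?In = (\<Sum>e\<in>edges G. of_bool (otail G ori e = v) + of_bool (ohead G ori e = v))"
    using fin by (simp add: sum.distrib Int_def)
  also have "\<dots> = degE G (edges G) v"
    unfolding degE_as_sum[OF fin] by (rule sum.cong) (auto simp: otail_def ohead_def)
  also have "\<dots> = 3" using assms(1,2) by (simp add: cubic_def)
  finally have sum3: "card ?Out + card ?In = 3" .
  then have "edges G \<noteq> {}" by (intro notI) simp
  then obtain e0 where e0: "e0 \<in> edges G" by blast
  \<comment> \<open>\<open>e0\<close> is the default edge for an empty \<open>A\<close>.\<close>
  have single: "\<exists>e\<in>edges G. A \<subseteq> {e}" if "A \<subseteq> edges G" "card A \<le> 1" for A
  proof -
    have "finite A" using that fin finite_subset by blast
    then have "\<forall>k\<in>A. \<forall>l\<in>A. k = l" using that(2) card_le_Suc0_iff_eq by auto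
    then show ?thesis using e0 that(1) by (cases "A = {}") blast+
  qed
  have "card ?Out \<le> 1 \<or> card ?In \<le> 1" using sum3 by linarith
  then obtain e where e: "e \<in> edges G" "?Out \<subseteq> {e} \<or> ?In \<subseteq> {e}"
    using single[of ?Out] single[of ?In] by blast
  \<comment> \<open>Without \<open>e\<close>, the vertex \<open>v\<close> has no outgoing or no
    incoming edge.\<close>
  have "\<not> strong (G\<lparr>edges := edges G - {e}\<rparr>) ori"
    by (rule not_strong_isolated[of v _ w]) (use assms e(2) in \<open>auto simp: otail_def ohead_def\<close>)
  then show ?thesis using that e(1) by (auto simp: deletable_def)
qed

section \<open>Smoothing\<close>

text \<open>This replaces the two \<open>SOME\<close> choices by the actual pair of edges at
  \<open>x\<close>; the absence of loops makes degree 2 mean two distinct edges.\<close>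

lemma smooth_vertexE:
  assumes wf: "wf_graph K" and deg: "degE K (edges K) x = 2"
    and noloop: "\<And>e. e \<in> edges K \<Longrightarrow> src K e = x \<Longrightarrow> tgt K e \<noteq> x"
  obtains f g p q where "inc K x = {f, g}" "f \<noteq> g" "joins K f x p" "joins K g x q" "p \<noteq> x" "q \<noteq> x"
    "smooth_vertex K x n = \<lparr>verts = verts K - {x}, edges = (edges K - {f, g}) \<union> {n},
       ends = (ends K)(n := (p, q))\<rparr>"
proof -
  have fin: "finite (edges K)" using wf by (simp add: wf_graph_def)
  have "inc K x = {e\<in>edges K. src K e = x} \<union> {e\<in>edges K. tgt K e = x}"
    by (auto simp: inc_def incident_def)
  also have "card \<dots> = card {e\<in>edges K. src K e = x} + card {e\<in>edges K. tgt K e = x}"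
    by (rule card_Un_disjoint) (use fin noloop in auto)
  finally have c2: "card (inc K x) = 2" using deg by (simp add: degE_def)
  define f where "f = (SOME f. f \<in> inc K x)"
  define g where "g = (SOME g. g \<in> inc K x - {f})"
  have "inc K x \<noteq> {}" using c2 by auto
  then have f: "f \<in> inc K x" unfolding f_def by (simp add: some_in_eq)
  have fi: "finite (inc K x)" using fin by (simp add: inc_def)
  have "card (inc K x - {f}) = 1" using c2 f fi by simp
  then have "inc K x - {f} \<noteq> {}" by (metis card.empty zero_neq_one)
  then have g: "g \<in> inc K x - {f}" unfolding g_def using some_in_eq by metis
  have inc: "inc K x = {f, g}" 
    using c2 f g fi by (intro card_subset_eq[symmetric]) auto
  have j: "joins K k x (other K k x)" "other K k x \<noteq> x" if "k \<in> inc K x" for k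
    using that noloop[of k] by (auto simp: joins_def other_def inc_def incident_def prod_eq_iff)
  have "smooth_vertex K x n = \<lparr>verts = verts K - {x}, edges = (edges K - inc K x) \<union> {n},
       ends = (ends K)(n := (other K f x, other K g x))\<rparr>"
    unfolding smooth_vertex_def f_def[symmetric] g_def[symmetric] Let_def by (rule refl)
  then show ?thesis using that[OF inc _ j(1)[OF f] j(1)[of g] j(2)[OF f] j(2)[of g]] inc g by auto
qed

text \<open>\<open>S\<close> collects the vertices to be smoothed, \<open>T\<close> the remaining edges between them.
  As \<open>x\<close> meets at most one edge of \<open>T\<close>, the new edge does not join two vertices of \<open>S\<close>.\<close>
lemma smooth_vertex_step:
  assumes wf: "wf_graph K" and x: "x \<in> verts K" "x \<in> S" and deg: "degE K (edges K) x = 2"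
    and n: "n \<notin> edges K" "n \<notin> T" "n \<notin> Q"
    and T: "\<forall>e\<in>edges K. src K e \<in> S \<and> tgt K e \<in> S \<longrightarrow> e \<in> T"
    and T_loop: "\<forall>e\<in>T. src K e \<noteq> tgt K e"
    and T_one: "T \<inter> inc K x \<subseteq> {d}"
    and Q: "Q \<inter> inc K x = {}"
  defines "K' \<equiv> smooth_vertex K x n"
  shows "wf_graph K'" "verts K' = verts K - {x}"
    "\<And>v. v \<noteq> x \<Longrightarrow> degE K' (edges K') v = degE K (edges K) v"
    "\<forall>e\<in>edges K'. src K' e \<in> S \<and> tgt K' e \<in> S \<longrightarrow> e \<in> T"
    "\<And>e. e \<noteq> n \<Longrightarrow> ends K' e = ends K e"
    "edges K' = (edges K - inc K x) \<union> {n}"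
    "\<And>X. card (cut K' (X - {x}) - Q) \<le> card (cut K X - Q)"
proof -
  have noloop: "tgt K e \<noteq> x" if "e \<in> edges K" "src K e = x" for e
    using T T_loop that x by metis
  obtain f g p q where fg: "inc K x = {f, g}" "f \<noteq> g" "joins K f x p" "joins K g x q" "p \<noteq> x" "q \<noteq> x"
    and K'0: "smooth_vertex K x n = \<lparr>verts = verts K - {x}, edges = (edges K - {f, g}) \<union> {n},
       ends = (ends K)(n := (p, q))\<rparr>"
    using smooth_vertexE[OF wf deg noloop] by metis
  have K': "verts K' = verts K - {x}" "edges K' = (edges K - {f, g}) \<union> {n}" "ends K' n = (p, q)"
    "\<And>e. e \<noteq> n \<Longrightarrow> ends K' e = ends K e"
    unfolding K'_def K'0 by simp_all
  have fgE: "f \<in> edges K" "g \<in> edges K" using fg(1) by (auto simp: inc_def)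
  have fin: "finite (edges K)" using wf by (simp add: wf_graph_def)
  have nonx: "src K e \<noteq> x" "tgt K e \<noteq> x" if "e \<in> edges K - {f, g}" for e
    using that fg(1) by (auto simp: inc_def incident_def)
  have pq: "p \<in> verts K" "q \<in> verts K"
    using fg(3,4) fgE wf by (auto simp: joins_def wf_graph_def)
  show "verts K' = verts K - {x}" "\<And>e. e \<noteq> n \<Longrightarrow> ends K' e = ends K e"
    "edges K' = (edges K - inc K x) \<union> {n}"
    using K' fg(1) by auto
  show "wf_graph K'"
    unfolding wf_graph_def
  proof (intro conjI ballI)
    show "finite (verts K')" "finite (edges K')" using wf K' by (auto simp: wf_graph_def)
    fix e assume "e \<in> edges K'"
    then consider "e = n" | "e \<in> edges K - {f, g}" "e \<noteq> n" using K'(2) by blast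
    then show "src K' e \<in> verts K'" "tgt K' e \<in> verts K'"
    proof (atomize (full), cases)
      case 2
      then show "src K' e \<in> verts K' \<and> tgt K' e \<in> verts K'"
        using nonx[OF 2(1)] K'(1) K'(4)[OF 2(2)] wf by (auto simp: wf_graph_def)
    qed (use K' pq fg in auto)
  qed
  show "degE K' (edges K') v = degE K (edges K) v" if v: "v \<noteq> x" for v
  proof -
    let ?w = "\<lambda>K e. of_bool (src K e = v) + of_bool (tgt K e = v) :: nat"
    have f: "?w K f = of_bool (p = v)" using fg(3) v by (auto simp: joins_def)
    have g: "?w K g = of_bool (q = v)" using fg(4) v by (auto simp: joins_def)
    \<comment> \<open>The new edge takes over the contributions of \<open>f\<close> and
      \<open>g\<close> at their far ends; if \<open>p = q\<close>, it is a loop and counts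
      twice.\<close>
    have "degE K (edges K) v = ?w K f + (?w K g + (\<Sum>e\<in>edges K - {f} - {g}. ?w K e))"
      unfolding degE_as_sum[OF fin]
      using sum.remove[of "edges K" f "?w K"] sum.remove[of "edges K - {f}" g "?w K"] fin fgE fg(2) by simp
    also have "\<dots> = ?w K' n + (\<Sum>e\<in>edges K - {f, g}. ?w K e)"
      unfolding f g K'(3) by (simp add: Diff_insert2[symmetric] insert_commute)
    also have "(\<Sum>e\<in>edges K - {f, g}. ?w K e) = (\<Sum>e\<in>edges K - {f, g}. ?w K' e)"
      using n(1) K'(4) by (intro sum.cong[OF refl]) (metis DiffD1)
    also have "?w K' n + \<dots> = degE K' (edges K') v"
      using fin n(1) by (simp add: degE_as_sum K'(2))
    finally show ?thesis by simp
  qed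
  have "e \<in> T" if e: "e \<in> edges K'" "src K' e \<in> S" "tgt K' e \<in> S" for e
  proof (cases "e = n")
    case True
    then have "p \<in> S" "q \<in> S" using e K'(3) by auto
    then have "f \<in> T" "g \<in> T" using T fgE fg(3,4) x(2) by (auto simp: joins_def)
    then show ?thesis using T_one fg(1,2) by auto
  next
    case False
    then show ?thesis using e K'(2,4) T by auto
  qed
  then show "\<forall>e\<in>edges K'. src K' e \<in> S \<and> tgt K' e \<in> S \<longrightarrow> e \<in> T" by blast
  \<comment> \<open>\<open>Q\<close> lists edges to be ignored in the cut, such as one that is
    deleted only after \<open>x\<close> has been smoothed; none of them is at
    \<open>x\<close>.\<close>
  show "card (cut K' (X - {x}) - Q) \<le> card (cut K X - Q)" for X
  proof -
    let ?R = "cut K X - Q - {f, g}"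
    have sub: "cut K' (X - {x}) - Q \<subseteq> ?R \<union> {n}"
    proof
      fix e assume e: "e \<in> cut K' (X - {x}) - Q"
      show "e \<in> ?R \<union> {n}"
      proof (cases "e = n")
        case False
        then have "e \<in> edges K - {f, g}" using e K'(2) by (auto simp: cut_def)
        then show ?thesis using e nonx[of e] K'(4)[OF False] by (auto simp: cut_def)
      qed simp
    qed
    have fR: "finite (cut K X)" using fin by (simp add: cut_def)
    show ?thesis
    proof (cases "n \<in> cut K' (X - {x})")
      case True
      \<comment> \<open>If the new edge crosses the cut, \<open>p\<close> and \<open>q\<close> are
        separated, so \<open>f\<close> or \<open>g\<close> crossed before and pays for it.\<close>
      then have "(p \<in> X) \<noteq> (q \<in> X)" using K'(3) fg(5,6) by (auto simp: cut_def)
      then have "f \<in> cut K X \<or> g \<in> cut K X" using fg(3,4) fgE by (auto simp: cut_def joins_def)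
      moreover have "f \<notin> Q" "g \<notin> Q" using Q fg(1) by auto
      ultimately have "\<exists>k. k \<in> cut K X - Q \<and> k \<notin> ?R" by blast
      then have "?R \<subset> cut K X - Q" by blast
      then have "card ?R < card (cut K X - Q)" using fR by (intro psubset_card_mono) auto
      moreover have "card (cut K' (X - {x}) - Q) \<le> card (?R \<union> {n})"
        using sub fR by (intro card_mono) auto
      moreover have "card (?R \<union> {n}) \<le> card ?R + 1" using fR by (simp add: card_insert_if)
      ultimately show ?thesis by linarith
    next
      case False
      then have "cut K' (X - {x}) - Q \<subseteq> cut K X - Q" using sub by blast
      then show ?thesis using fR by (intro card_mono) auto
    qed
  qed
qed

lemma degE_delete:
  assumes "finite (edges K)" "e \<in> edges K"
  shows "degE (K\<lparr>edges := edges K - {e}\<rparr>) (edges K - {e}) v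
    + (of_bool (src K e = v) + of_bool (tgt K e = v)) = degE K (edges K) v"
  using assms by (simp add: degE_as_sum sum.remove[of _ e])

text \<open>Neither deletion nor smoothing enlarges the cut, and \<open>e\<close>, avoiding all
  smoothed vertices, survives and still crosses it. Fewer than three cut edges besides
  \<open>a\<close> and \<open>c\<close> would thus give a proper cut of fewer than three edges in
  the cubic graph \<open>smooth2 G a c\<close>; one side would be acyclic, which forces at least
  three.\<close>

lemma smooth2_cut:
  fixes G :: "('v,'e) mgraph"
  assumes cub: "cubic G" and conn: "cyc_edge_conn (smooth2 G a c) 3"
    and a: "a \<in> edges G" "joins G a x1 y1" and c: "c \<in> edges G" "joins G c y2 x2"
    and dist: "distinct [x1, y1, y2, x2]"
    and S: "\<And>e. e \<in> edges G \<Longrightarrow> src G e \<in> {x1, y1, y2, x2} \<Longrightarrow> tgt G e \<in> {x1, y1, y2, x2} \<Longrightarrow> e \<in> {a, b, c}"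
    and b: "src G b \<noteq> tgt G b"
    and X: "X \<subseteq> verts G" "e \<in> cut G X" "\<And>v. v \<in> {x1, y1, y2, x2} \<Longrightarrow> \<not> incident G e v"
  shows "3 \<le> card (cut G X - {a, c})"
proof -
  let ?S = "{x1, y1, y2, x2}"
  \<comment> \<open>\<open>smooth_edge\<close> treats the \<open>fst\<close> end first, and which of
    the two vertices that is depends on the reference direction, so the ends are renamed.\<close>
  define p q p' q' where "p = src G a" and "q = tgt G a" and "p' = src G c" and "q' = tgt G c"
  have pq: "{p, q} = {x1, y1}" "p \<noteq> q" and pq': "{p', q'} = {x2, y2}" "p' \<noteq> q'"
    using a(2) c(2) dist by (auto simp: joins_def p_def q_def p'_def q'_def)
  then have d4: "distinct [p, q, p', q']" using dist by (auto simp: doubleton_eq_iff)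
  have S4: "?S = {p, q, p', q'}" using pq pq' by auto
  have wfG: "wf_graph G" using cub by (simp add: cubic_def)
  have V: "p \<in> verts G" "q \<in> verts G" "p' \<in> verts G" "q' \<in> verts G"
    using wfG a(1) c(1) by (auto simp: wf_graph_def p_def q_def p'_def q'_def)
  have ac: "a \<noteq> c" using d4 by (auto simp: p_def p'_def)
  \<comment> \<open>The chain follows \<open>smooth2\<close>: delete \<open>a\<close>, smooth
    \<open>p\<close> and \<open>q\<close>, then delete \<open>c\<close>, smooth \<open>p'\<close>
    and \<open>q'\<close>.\<close>
  define K0 where "K0 = lift G"
  define K1 where "K1 = K0\<lparr>edges := edges K0 - {Inl a}\<rparr>"
  define K2 where "K2 = smooth_vertex K1 p (Inr 0)"
  define K3 where "K3 = smooth_vertex K2 q (Inr 1)"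
  define K4 where "K4 = K3\<lparr>edges := edges K3 - {Inl c}\<rparr>"
  define K5 where "K5 = smooth_vertex K4 p' (Inr 2)"
  define K6 where "K6 = smooth_vertex K5 q' (Inr 3)"
  have K0: "verts K0 = verts G" "edges K0 = Inl ` edges G" "\<And>k. ends K0 (Inl k) = ends G k"
    by (simp_all add: K0_def lift_def)
  have wf0: "wf_graph K0" using wfG by (auto simp: wf_graph_def K0)
  have deg0: "degE K0 (edges K0) v = degE G (edges G) v" for v
  proof -
    have "finite (edges G)" "finite (edges K0)" using wfG wf0 by (auto simp: wf_graph_def)
    then show ?thesis by (simp add: degE_as_sum) (simp add: K0 sum.reindex)
  qed
  have K1: "verts K1 = verts G" "edges K1 = Inl ` edges G - {Inl a}" "\<And>k. ends K1 (Inl k) = ends G k"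
    by (simp_all add: K1_def K0)
  have wf1: "wf_graph K1" using wf0 by (auto simp: wf_graph_def K1_def)
  have deg1: "degE K1 (edges K1) v + (of_bool (p = v) + of_bool (q = v)) = 3" if "v \<in> verts G" for v
    using degE_delete[of K0 "Inl a" v] wf0 a(1) cub that
    using deg0[of v] by (auto simp: K1_def K0 wf_graph_def p_def q_def cubic_def)
  have T1: "\<forall>k\<in>edges K1. src K1 k \<in> ?S \<and> tgt K1 k \<in> ?S \<longrightarrow> k \<in> {Inl b, Inl c}"
  proof (intro ballI impI)
    fix k assume asm: "k \<in> edges K1" "src K1 k \<in> ?S \<and> tgt K1 k \<in> ?S"
    obtain l where l: "k = Inl l" "l \<in> edges G" "l \<noteq> a" using asm(1) by (auto simp: K1)
    then have "l \<in> {a, b, c}" using S[of l] asm(2) by (simp add: K1)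
    then show "k \<in> {Inl b, Inl c}" using l by blast
  qed
  have bc_loop: "src G k \<noteq> tgt G k" if "k \<in> {b, c}" for k
    using that b d4 by (auto simp: p'_def q'_def)
  have c_inc: "\<not> incident G c p" "\<not> incident G c q"
    using d4 by (auto simp: incident_def p'_def q'_def)
  have one1: "{Inl b, Inl c} \<inter> inc K1 p \<subseteq> {Inl b}" "{Inl c} \<inter> inc K1 p = {}"
    using c_inc by (auto simp: inc_def incident_def K1)
  have "degE K1 (edges K1) p = 2" using deg1[OF V(1)] pq(2) by simp
  note step1 = smooth_vertex_step[where K = K1 and x = p and S = ?S and n = "Inr 0" and Q = "{Inl c}", folded K2_def,
      OF wf1 _ _ this _ _ _ T1 _ one1]
  have step1_conds: "p \<in> verts K1" "p \<in> ?S" "Inr 0 \<notin> edges K1" "Inr 0 \<notin> {Inl b, Inl c}" "Inr 0 \<notin> {Inl c}"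
    "\<forall>k\<in>{Inl b, Inl c}. src K1 k \<noteq> tgt K1 k"
    using V S4 bc_loop by (auto simp: K1)
  note K2 = step1[OF step1_conds]
  have ends2: "ends K2 (Inl k) = ends G k" for k using K2(5) by (simp add: K1)
  have one2: "{Inl b, Inl c} \<inter> inc K2 q \<subseteq> {Inl b}" "{Inl c} \<inter> inc K2 q = {}"
    using c_inc by (auto simp: inc_def incident_def ends2)
  have "degE K2 (edges K2) q = 2" using deg1[OF V(2)] pq(2) by (simp add: K2(3))
  note step2 = smooth_vertex_step[where K = K2 and x = q and S = ?S and n = "Inr 1" and Q = "{Inl c}", folded K3_def,
      OF K2(1) _ _ this _ _ _ K2(4) _ one2]
  have step2_conds: "q \<in> verts K2" "q \<in> ?S" "Inr 1 \<notin> edges K2" "Inr 1 \<notin> {Inl b, Inl c}" "Inr 1 \<notin> {Inl c}"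
    "\<forall>k\<in>{Inl b, Inl c}. src K2 k \<noteq> tgt K2 k"
    using V S4 bc_loop pq(2) by (auto simp: K1 K2(2,6) ends2)
  note K3 = step2[OF step2_conds]
  have ends3: "ends K3 (Inl k) = ends G k" for k using K3(5) by (simp add: ends2)
  \<comment> \<open>\<open>c\<close> has survived the first two smoothings, so its deletion really
    lowers the degrees of its ends to 2.\<close>
  have c3: "Inl c \<in> edges K3"
    using c ac one1(2) one2(2) by (auto simp: K1 K2(6) K3(6))
  have ends4: "ends K4 (Inl k) = ends G k" for k by (simp add: K4_def ends3)
  have wf4: "wf_graph K4" using K3(1) by (auto simp: wf_graph_def K4_def)
  have V4: "verts K4 = verts G - {p, q}" by (auto simp: K4_def K3(2) K2(2) K1)
  have E4: "edges K4 = edges K3 - {Inl c}" by (simp add: K4_def)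
  have deg3: "degE K3 (edges K3) v = 3" if "v \<in> verts G - {p, q}" for v
    using that K3(3) K2(3) deg1[of v] by auto
  have deg4: "degE K4 (edges K4) v + (of_bool (p' = v) + of_bool (q' = v)) = 3" if "v \<in> verts G - {p, q}" for v
    using degE_delete[of K3 "Inl c" v] K3(1) c3 deg3[OF that]
    by (auto simp: K4_def wf_graph_def p'_def q'_def ends3)
  have T4: "\<forall>k\<in>edges K4. src K4 k \<in> ?S \<and> tgt K4 k \<in> ?S \<longrightarrow> k \<in> {Inl b}"
    using K3(4) by (simp add: K4_def) blast
  have "degE K4 (edges K4) p' = 2" using deg4[of p'] V pq'(2) d4 by auto
  note step4 = smooth_vertex_step[where K = K4 and x = p' and S = ?S and n = "Inr 2" and Q = "{}" and d = "Inl b",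
      folded K5_def, OF wf4 _ _ this _ _ _ T4]
  have step4_conds: "p' \<in> verts K4" "p' \<in> ?S" "Inr 2 \<notin> edges K4" "Inr 2 \<notin> {Inl b}" "Inr 2 \<notin> {}"
    "\<forall>k\<in>{Inl b}. src K4 k \<noteq> tgt K4 k" "{Inl b} \<inter> inc K4 p' \<subseteq> {Inl b}" "{} \<inter> inc K4 p' = {}"
    using V S4 bc_loop d4 by (auto simp: V4 E4 K1 K2(6) K3(6) ends4)
  note K5 = step4[OF step4_conds]
  have ends5: "ends K5 (Inl k) = ends G k" for k using K5(5) by (simp add: ends4)
  have "degE K5 (edges K5) q' = 2" using deg4[of q'] V pq'(2) d4 K5(3)[of q'] by auto
  note step5 = smooth_vertex_step[where K = K5 and x = q' and S = ?S and n = "Inr 3" and Q = "{}" and d = "Inl b",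
      folded K6_def, OF K5(1) _ _ this _ _ _ K5(4)]
  have step5_conds: "q' \<in> verts K5" "q' \<in> ?S" "Inr 3 \<notin> edges K5" "Inr 3 \<notin> {Inl b}" "Inr 3 \<notin> {}"
    "\<forall>k\<in>{Inl b}. src K5 k \<noteq> tgt K5 k" "{Inl b} \<inter> inc K5 q' \<subseteq> {Inl b}" "{} \<inter> inc K5 q' = {}"
    using V S4 bc_loop d4 by (auto simp: V4 E4 K1 K2(6) K3(6) K5(2,6) ends5)
  note K6 = step5[OF step5_conds]
  have ends6: "ends K6 (Inl k) = ends G k" for k using K6(5) by (simp add: ends5)
  have V6: "verts K6 = verts G - ?S" unfolding S4 by (auto simp: K6(2) K5(2) V4)
  have "degE K6 (edges K6) v = 3" if "v \<in> verts K6" for v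
    using that d4 K6(3)[of v] K5(3)[of v] deg4[of v] by (auto simp: V6 S4)
  then have cub6: "cubic K6" using K6(1) by (simp add: cubic_def)
  have "smooth_edge K0 (Inl a) (Inr 0) (Inr 1) = K3"
    unfolding smooth_edge_def K3_def K2_def K1_def K0(3) p_def q_def ..
  moreover have "smooth_edge K3 (Inl c) (Inr 2) (Inr 3) = K6"
    unfolding smooth_edge_def K6_def K5_def K4_def ends3 p'_def q'_def ..
  ultimately have "smooth2 G a c = K6"
    by (simp only: smooth2_def K0_def[symmetric])
  then have conn6: "cyc_edge_conn K6 3" using conn by simp
  have e0: "e \<in> edges G" "e \<noteq> a" "e \<noteq> c"
      subgoal using X(2) by (simp add: cut_def)
  subgoal using X(3)[of x1] a(2) by (auto simp: incident_def joins_def)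
  subgoal using X(3)[of x2] c(2) by (auto simp: incident_def joins_def)
  done
  have ninc: "\<not> incident G e p" "\<not> incident G e q" "\<not> incident G e p'" "\<not> incident G e q'"
    using X(3) S4 by auto
  have e6: "Inl e \<in> edges K6"
    using e0 ninc by (auto simp: K6(6) K5(6) E4 K3(6) K2(6) K1 inc_def incident_def ends2 ends4 ends5)
  define Y where "Y = X - {p} - {q} - {p'} - {q'}"
  have e_cut: "Inl e \<in> cut K6 Y"
    using X(2) e6 ninc by (auto simp: cut_def Y_def ends6 incident_def)
  then have Yne: "Y \<noteq> {}" "Y \<noteq> verts K6"
    using K6(1) e6 by (auto simp: cut_def wf_graph_def)
  have Ysub: "Y \<subseteq> verts K6" using X(1) by (auto simp: Y_def V6 S4)
  have "card (cut K6 Y) \<le> card (cut K5 (X - {p} - {q} - {p'}))"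
    using K6(7)[of "X - {p} - {q} - {p'}"] by (simp add: Y_def)
  also have "\<dots> \<le> card (cut K4 (X - {p} - {q}))" using K5(7)[of "X - {p} - {q}"] by simp
  also have "cut K4 (X - {p} - {q}) = cut K3 (X - {p} - {q}) - {Inl c}" by (auto simp: cut_def K4_def)
  also have "card \<dots> \<le> card (cut K2 (X - {p}) - {Inl c})" by (rule K3(7))
  also have "\<dots> \<le> card (cut K1 X - {Inl c})" by (rule K2(7))
  also have "cut K1 X - {Inl c} = Inl ` (cut G X - {a, c})"
  proof -
    have "cut K1 X = {k\<in>Inl ` (edges G - {a}). (src K1 k \<in> X) \<noteq> (tgt K1 k \<in> X)}"
      unfolding cut_def K1(2) by blast
    also have "\<dots> = Inl ` {k\<in>edges G - {a}. (src G k \<in> X) \<noteq> (tgt G k \<in> X)}"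
      by (auto simp only: K1(3))
    finally show ?thesis unfolding cut_def by blast
  qed
  also have "card \<dots> = card (cut G X - {a, c})" by (rule card_image) simp
  finally have le: "card (cut K6 Y) \<le> card (cut G X - {a, c})" .
  show ?thesis
  proof (rule ccontr)
    assume "\<not> ?thesis"
    then have lt: "card (cut K6 Y) < 3" using le by simp
    obtain Z where "Z = Y \<or> Z = verts K6 - Y" "card Z + 2 \<le> card (cut K6 Y)" "Z \<noteq> {}" "finite Z"
      by (rule cyc_conn_cut[OF cub6 conn6 Ysub Yne lt])
    moreover have "card Z > 0" using calculation by (simp add: card_gt_0_iff)
    ultimately show False using lt by linarith
  qed
qed

section \<open>The two orientations\<close>

text \<open>The signs of \<open>\<phi>\<close> orient all edges but \<open>a\<close> and \<open>c\<close>, on which \<open>\<phi>\<close> vanishes;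
  \<open>a\<close> is directed towards \<open>x1\<close> and \<open>c\<close> towards \<open>y2\<close>.\<close>
definition bridge_ori :: "('v,'e) mgraph \<Rightarrow> ('e \<Rightarrow> int) \<Rightarrow> 'e \<Rightarrow> 'v \<Rightarrow> 'e \<Rightarrow> 'v \<Rightarrow> 'e \<Rightarrow> bool" where
  "bridge_ori G \<phi> a x1 c y2 k \<longleftrightarrow>
     (if k = a then src G a = x1 else if k = c then src G c = y2 else \<phi> k < 0)"

abbreviation ftail where "ftail G \<phi> \<equiv> otail G (\<lambda>k. \<phi> k < (0::int))"
abbreviation fhead where "fhead G \<phi> \<equiv> ohead G (\<lambda>k. \<phi> k < (0::int))"

text \<open>This is \<open>not_deletable_cut\<close> with zero set \<open>{a, c}\<close>. The
  flowless edges \<open>a\<close> and \<open>c\<close> are never the bad edge, so they too can only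
  enter \<open>X\<close>; this turns their directions into the two implications on
  \<open>x1\<close>, \<open>y1\<close>, \<open>x2\<close>, \<open>y2\<close>.\<close>

lemma bridge_cut:
  assumes wf: "wf_graph G"
    and conn: "\<forall>X\<subseteq>verts G. X \<noteq> {} \<longrightarrow> X \<noteq> verts G \<longrightarrow> 3 \<le> card (cut G X)"
    and a: "a \<in> edges G" "joins G a x1 y1" and c: "c \<in> edges G" "joins G c y2 x2"
    and dist: "distinct [x1, y1, y2, x2]"
    and fl: "is_flow G \<phi>" and zero: "\<forall>k\<in>edges G. \<phi> k = 0 \<longleftrightarrow> k \<in> {a, c}"
    and e: "e \<in> edges G" "\<not> deletable G (bridge_ori G \<phi> a x1 c y2) e"
  obtains X where "e \<notin> {a, c}" "X \<subseteq> verts G" "X \<noteq> {}" "X \<noteq> verts G"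
    "ftail G \<phi> e \<in> X" "fhead G \<phi> e \<notin> X"
    "\<forall>k\<in>edges G. k \<notin> {a, c, e} \<longrightarrow> ftail G \<phi> k \<in> X \<longrightarrow> fhead G \<phi> k \<in> X"
    "y1 \<in> X \<longrightarrow> x1 \<in> X" "x2 \<in> X \<longrightarrow> y2 \<in> X"
    "a \<in> cut G X \<longleftrightarrow> y1 \<notin> X \<and> x1 \<in> X" "c \<in> cut G X \<longleftrightarrow> x2 \<notin> X \<and> y2 \<in> X"
    "e \<in> cut G X" "(\<Sum>k\<in>cut G X - {e}. \<bar>\<phi> k\<bar>) = \<bar>\<phi> e\<bar>"
    "int (card (cut G X - {a, c})) \<le> \<bar>\<phi> e\<bar> + 1"
proof -
  let ?o = "bridge_ori G \<phi> a x1 c y2"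
  have "card {a, c} \<le> 2" by (simp add: card_insert_if)
  have sgn: "?o k \<longleftrightarrow> \<phi> k < 0" if "k \<in> edges G" "\<phi> k \<noteq> 0" for k
    using zero that by (auto simp: bridge_ori_def)
  obtain X where X: "X \<subseteq> verts G" "X \<noteq> {}" "X \<noteq> verts G" "otail G ?o e \<in> X" "ohead G ?o e \<notin> X"
    "\<And>k. k \<in> edges G \<Longrightarrow> k \<noteq> e \<Longrightarrow> otail G ?o k \<in> X \<Longrightarrow> ohead G ?o k \<in> X"
    "e \<in> cut G X" "\<phi> e \<noteq> 0" "(\<Sum>k\<in>cut G X - {e}. \<bar>\<phi> k\<bar>) = \<bar>\<phi> e\<bar>"
    "int (card (cut G X - {a, c})) \<le> \<bar>\<phi> e\<bar> + 1"
    by (rule not_deletable_cut[OF wf e fl sgn, of "{a, c}"])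
      (use zero conn \<open>card {a, c} \<le> 2\<close> in auto)
  have eac: "e \<notin> {a, c}" using zero e(1) X(8) by simp
  have ac: "a \<noteq> c" using a(2) c(2) dist by (auto simp: joins_def)
  have dirs: "otail G ?o a = y1" "ohead G ?o a = x1" "otail G ?o c = x2" "ohead G ?o c = y2"
  proof -
    have "src G a = x1 \<and> tgt G a = y1 \<or> src G a = y1 \<and> tgt G a = x1"
      "src G c = y2 \<and> tgt G c = x2 \<or> src G c = x2 \<and> tgt G c = y2"
      using a(2) c(2) by (auto simp: joins_def)
    then show "otail G ?o a = y1" "ohead G ?o a = x1" "otail G ?o c = x2" "ohead G ?o c = y2"
      using dist ac by (auto simp: otail_def ohead_def bridge_ori_def)
  qed
  have fdir: "otail G ?o k = ftail G \<phi> k" "ohead G ?o k = fhead G \<phi> k" if "k \<notin> {a, c}" for k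
    using that by (auto simp: otail_def ohead_def bridge_ori_def)
  have y1: "y1 \<in> X \<longrightarrow> x1 \<in> X" using X(6)[OF a(1)] eac dirs by auto
  have x2: "x2 \<in> X \<longrightarrow> y2 \<in> X" using X(6)[OF c(1)] eac dirs by auto
  have "a \<in> cut G X \<longleftrightarrow> (y1 \<in> X) \<noteq> (x1 \<in> X)" "c \<in> cut G X \<longleftrightarrow> (x2 \<in> X) \<noteq> (y2 \<in> X)"
    using a c by (auto simp: cut_def joins_def)
  then have "a \<in> cut G X \<longleftrightarrow> y1 \<notin> X \<and> x1 \<in> X" "c \<in> cut G X \<longleftrightarrow> x2 \<notin> X \<and> y2 \<in> X"
    using y1 x2 by auto
  moreover have "\<forall>k\<in>edges G. k \<notin> {a, c, e} \<longrightarrow> ftail G \<phi> k \<in> X \<longrightarrow> fhead G \<phi> k \<in> X"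
  proof (intro ballI impI)
    fix k assume k: "k \<in> edges G" "k \<notin> {a, c, e}" "ftail G \<phi> k \<in> X"
    then show "fhead G \<phi> k \<in> X" using X(6)[of k] fdir[of k] by simp
  qed
  ultimately show ?thesis
    using that[OF eac X(1-3) _ _ _ y1 x2 _ _ X(7) X(9,10)] X(4,5) fdir[OF eac] by auto
qed

text \<open>An edge deletable in neither orientation yields a bad cut \<open>X\<close> for
  \<open>\<phi>1\<close> and \<open>Y\<close> for \<open>\<phi>2\<close>. Ordinary edges are
  excluded by \<open>off\<close>. For \<open>f1\<close>, \<open>g2\<close>, \<open>b\<close> the set
  \<open>X\<close> is used, for \<open>g1\<close>, \<open>f2\<close>, \<open>h1\<close>,
  \<open>h2\<close> the set \<open>Y\<close>: the direction of the edge there keeps \<open>a\<close>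
  or \<open>c\<close> out of the cut, which brings its size down to at most three.\<close>

lemma two_orientations:
  fixes G :: "('v,'e) mgraph" and \<phi>1 \<phi>2 :: "'e \<Rightarrow> int"
  assumes wf: "wf_graph G"
    and conn: "\<forall>X\<subseteq>verts G. X \<noteq> {} \<longrightarrow> X \<noteq> verts G \<longrightarrow> 3 \<le> card (cut G X)"
    and triv: "\<And>X. X \<subseteq> verts G \<Longrightarrow> X \<noteq> {} \<Longrightarrow> X \<noteq> verts G \<Longrightarrow> card (cut G X) \<le> 3 \<Longrightarrow>
      \<exists>v. X = {v} \<or> verts G - X = {v}"
    and a: "a \<in> edges G" "joins G a x1 y1" and c: "c \<in> edges G" "joins G c y2 x2"
    and dist: "distinct [x1, y1, y2, x2]"
    and off: "\<And>X e. X \<subseteq> verts G \<Longrightarrow> e \<in> cut G X \<Longrightarrow> e \<notin> {a, c, b, f1, g1, f2, g2, h1, h2} \<Longrightarrow>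
      3 \<le> card (cut G X - {a, c})"
    and fl1: "is_flow G \<phi>1" and zero1: "\<forall>k\<in>edges G. \<phi>1 k = 0 \<longleftrightarrow> k \<in> {a, c}"
    and fl2: "is_flow G \<phi>2" and zero2: "\<forall>k\<in>edges G. \<phi>2 k = 0 \<longleftrightarrow> k \<in> {a, c}"
    and one: "\<And>e. e \<in> edges G \<Longrightarrow> e \<notin> {a, c, b, f1, g1, f2, g2, h1, h2} \<Longrightarrow> \<bar>\<phi>1 e\<bar> = 1 \<or> \<bar>\<phi>2 e\<bar> = 1"
    and E: "b \<in> edges G" "f1 \<in> edges G" "g2 \<in> edges G"
    and dir1: "ftail G \<phi>1 f1 = u1" "fhead G \<phi>1 f1 = x1" "ftail G \<phi>1 b = y1" "fhead G \<phi>1 b = y2"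
      "ftail G \<phi>1 g2 = x2" "fhead G \<phi>1 g2 = v2"
    and val1: "\<bar>\<phi>1 f1\<bar> = 2" "\<bar>\<phi>1 b\<bar> = 2" "\<bar>\<phi>1 g2\<bar> = 2"
    and dir2: "ftail G \<phi>2 g1 = v1" "fhead G \<phi>2 g1 = x1" "ftail G \<phi>2 f2 = x2" "fhead G \<phi>2 f2 = u2"
      "ftail G \<phi>2 h1 = y1" "fhead G \<phi>2 h1 = w1" "ftail G \<phi>2 h2 = w2" "fhead G \<phi>2 h2 = y2"
    and val2: "\<bar>\<phi>2 g1\<bar> = 1" "\<bar>\<phi>2 f2\<bar> = 1" "\<bar>\<phi>2 h1\<bar> = 1" "\<bar>\<phi>2 h2\<bar> = 1"
    and m: "\<exists>m\<in>cut G {u1}. 3 \<le> \<bar>\<phi>1 m\<bar>" "\<exists>m\<in>cut G {v2}. 3 \<le> \<bar>\<phi>1 m\<bar>"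
    and nonadj: "v1 \<notin> {x2, y2}" "u2 \<notin> {x1, y1}" "w1 \<notin> {x2, y2}" "w2 \<notin> {x1, y1}"
    and e: "e \<in> edges G"
  shows "deletable G (bridge_ori G \<phi>1 a x1 c y2) e \<or> deletable G (bridge_ori G \<phi>2 a x1 c y2) e"
proof (rule ccontr)
  assume "\<not> ?thesis"
  then have nd: "\<not> deletable G (bridge_ori G \<phi>1 a x1 c y2) e" "\<not> deletable G (bridge_ori G \<phi>2 a x1 c y2) e"
    by auto
  obtain X where X: "e \<notin> {a, c}" "X \<subseteq> verts G" "X \<noteq> {}" "X \<noteq> verts G"
    "ftail G \<phi>1 e \<in> X" "fhead G \<phi>1 e \<notin> X"
    "\<forall>k\<in>edges G. k \<notin> {a, c, e} \<longrightarrow> ftail G \<phi>1 k \<in> X \<longrightarrow> fhead G \<phi>1 k \<in> X"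
    "y1 \<in> X \<longrightarrow> x1 \<in> X" "x2 \<in> X \<longrightarrow> y2 \<in> X"
    "a \<in> cut G X \<longleftrightarrow> y1 \<notin> X \<and> x1 \<in> X" "c \<in> cut G X \<longleftrightarrow> x2 \<notin> X \<and> y2 \<in> X"
    "e \<in> cut G X" "(\<Sum>k\<in>cut G X - {e}. \<bar>\<phi>1 k\<bar>) = \<bar>\<phi>1 e\<bar>"
    "int (card (cut G X - {a, c})) \<le> \<bar>\<phi>1 e\<bar> + 1"
    by (rule bridge_cut[OF wf conn a c dist fl1 zero1 e nd(1)])
  obtain Y where "e \<notin> {a, c}" and Y: "Y \<subseteq> verts G" "Y \<noteq> {}" "Y \<noteq> verts G"
    "ftail G \<phi>2 e \<in> Y" "fhead G \<phi>2 e \<notin> Y"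
    and "\<forall>k\<in>edges G. k \<notin> {a, c, e} \<longrightarrow> ftail G \<phi>2 k \<in> Y \<longrightarrow> fhead G \<phi>2 k \<in> Y"
    and Y':
    "y1 \<in> Y \<longrightarrow> x1 \<in> Y" "x2 \<in> Y \<longrightarrow> y2 \<in> Y"
    "a \<in> cut G Y \<longleftrightarrow> y1 \<notin> Y \<and> x1 \<in> Y" "c \<in> cut G Y \<longleftrightarrow> x2 \<notin> Y \<and> y2 \<in> Y"
    "e \<in> cut G Y" and "(\<Sum>k\<in>cut G Y - {e}. \<bar>\<phi>2 k\<bar>) = \<bar>\<phi>2 e\<bar>"
    and Y'': "int (card (cut G Y - {a, c})) \<le> \<bar>\<phi>2 e\<bar> + 1"
    by (rule bridge_cut[OF wf conn a c dist fl2 zero2 e nd(2)])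
  note Y = Y Y' Y''
  have fin: "finite (cut G Z)" for Z using wf by (auto simp: cut_def wf_graph_def)
  have V: "x1 \<in> verts G" "y1 \<in> verts G" "y2 \<in> verts G" "x2 \<in> verts G"
    using wf a c by (auto simp: wf_graph_def joins_def)
  have b_fg: "b \<noteq> f1" "b \<noteq> g2" "b \<notin> {a, c}"
    subgoal using dir1(2,4) dist by auto
    subgoal using dir1(3,5) dist by auto
    subgoal using val1(2) zero1 E(1) by auto
    done
  have card_le: "card (cut G Z) \<le> card (cut G Z - {a, c}) + 1" if asm: "a \<notin> cut G Z \<or> c \<notin> cut G Z" for Z
  proof -
    obtain k where "cut G Z \<subseteq> insert k (cut G Z - {a, c})" using asm by blast
    then have "card (cut G Z) \<le> card (insert k (cut G Z - {a, c}))"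
      using fin by (intro card_mono) auto
    also have "\<dots> \<le> card (cut G Z - {a, c}) + 1" using fin by (simp add: card_insert_if)
    finally show ?thesis .
  qed
  have card_eq: "card (cut G Z) = card (cut G Z - {a, c})" if "a \<notin> cut G Z" "c \<notin> cut G Z" for Z
    using that by (simp add: Diff_triv)
  \<comment> \<open>If \<open>b\<close> crosses a cut whose bad edge has value 2, it already
    supplies all the flow, so besides \<open>e\<close> and \<open>b\<close> only one of
    \<open>a\<close>, \<open>c\<close> can cross.\<close>
  have b_cut: "card (cut G X) \<le> 3" if "b \<in> cut G X" "\<bar>\<phi>1 e\<bar> = 2" "e \<noteq> b" "a \<notin> cut G X \<or> c \<notin> cut G X"
  proof -
    have "(\<Sum>k\<in>cut G X - {e}. \<bar>\<phi>1 k\<bar>) = \<bar>\<phi>1 b\<bar> + (\<Sum>k\<in>cut G X - {e} - {b}. \<bar>\<phi>1 k\<bar>)"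
      using fin that by (intro sum.remove) auto
    then have "(\<Sum>k\<in>cut G X - {e} - {b}. \<bar>\<phi>1 k\<bar>) = 0" using X(13) that val1 by simp
    then have "\<forall>k\<in>cut G X - {e} - {b}. \<phi>1 k = 0"
      using fin by (subst (asm) sum_nonneg_eq_0_iff) auto
    then have "cut G X - {e} - {b} \<subseteq> {a, c}" using zero1 by (auto simp: cut_def)
    then have "cut G X - {a, c} \<subseteq> {e, b}" by blast
    then have "card (cut G X - {a, c}) \<le> card {e, b}" by (intro card_mono) auto
    also have "\<dots> \<le> 2" by (simp add: card_insert_if)
    finally show ?thesis using card_le[OF that(4)] by linarith
  qed
  have big: False if "k \<in> cut G X" "3 \<le> \<bar>\<phi>1 k\<bar>" "\<bar>\<phi>1 e\<bar> = 2" for k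
  proof -
    have "\<bar>\<phi>1 k\<bar> \<le> (\<Sum>k\<in>cut G X - {e}. \<bar>\<phi>1 k\<bar>)"
      using fin that by (intro member_le_sum) auto
    then show False using X(13) that by simp
  qed
  have single: "w = v" if "verts G - Z = {v}" "w \<in> verts G" "w \<notin> Z" for w v Z
    using that by (metis DiffI singletonD)
  have cutc: "cut G X = cut G {v}" if "verts G - X = {v}" for v
    using cut_compl[OF wf, of X] that by simp
  consider "\<bar>\<phi>1 e\<bar> = 1" "e \<notin> {a, c, b, f1, g1, f2, g2, h1, h2}"
    | "\<bar>\<phi>2 e\<bar> = 1" "e \<notin> {a, c, b, f1, g1, f2, g2, h1, h2}"
    | "e = f1" | "e = g2" | "e = b" | "e = g1" | "e = f2" | "e = h1" | "e = h2"
    using one[OF e] X(1) by blast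
  then show False
  proof cases
    \<comment> \<open>Value 1 leaves at most two cut edges besides \<open>a\<close> and
      \<open>c\<close>, against \<open>off\<close>.\<close>
    case 1
    then show False using off[OF X(2,12)] X(14) by simp
  next
    case 2
    then show False using off[OF Y(1,10)] Y(11) by simp
  next
    case 3
    \<comment> \<open>Since \<open>a\<close> points to \<open>x1\<close>, which is outside,
      \<open>y1\<close> is outside too and \<open>a\<close> does not cross.\<close>
    then have u: "u1 \<in> X" "x1 \<notin> X" "y1 \<notin> X" "a \<notin> cut G X" using X dir1 by auto
    have c3: "card (cut G X) \<le> 3"
    proof (cases "c \<in> cut G X")
      case True
      then have "y2 \<in> X" using X by auto
      then have "b \<in> cut G X" using u(3) E(1) dir1 by (auto simp: cut_def otail_def ohead_def split: if_splits)
      then show ?thesis using b_cut 3 b_fg u(4) val1 by auto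
    next
      case False
      then show ?thesis using card_eq[OF u(4)] X(14) 3 val1 by simp
    qed
    then consider v where "X = {v}" | v where "verts G - X = {v}" using triv[OF X(2-4)] by blast
    then show False
    proof cases
      case 1
      \<comment> \<open>The star of \<open>u1\<close> contains an edge of value at least 3, but all
        edges other than \<open>f1\<close> together carry only 2.\<close>
      then have "X = {u1}" using u by auto
      then show False using m(1) big 3 val1 by blast
    next
      case (2 v)
      then have "x1 = v" "y1 = v" using single[OF 2] u V by auto
      then show False using dist by simp
    qed
  next
    case 4
    then have u: "x2 \<in> X" "v2 \<notin> X" "y2 \<in> X" "c \<notin> cut G X" using X dir1 by auto
    have c3: "card (cut G X) \<le> 3"
    proof (cases "a \<in> cut G X")
      case True
      then have "y1 \<notin> X" using X by auto
      then have "b \<in> cut G X" using u(3) E(1) dir1 by (auto simp: cut_def otail_def ohead_def split: if_splits)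
      then show ?thesis using b_cut 4 b_fg u(4) val1 by auto
    next
      case False
      then show ?thesis using card_eq[OF _ u(4)] X(14) 4 val1 by simp
    qed
    then consider v where "X = {v}" | v where "verts G - X = {v}" using triv[OF X(2-4)] by blast
    then show False
    proof cases
      case 1
      then show False using u dist by auto
    next
      case (2 v)
      have "v2 \<in> verts G" using wf E(3) dir1(6) by (auto simp: wf_graph_def ohead_def split: if_splits)
      then have "v = v2" using single[OF 2] u by simp
      then show False using m(2) big 4 val1 cutc[OF 2] by auto
    qed
  next
    case 5
    \<comment> \<open>\<open>a\<close> has both ends inside and \<open>c\<close> both outside, so
      neither crosses and neither side is a single vertex.\<close>
    then have u: "y1 \<in> X" "x1 \<in> X" "y2 \<notin> X" "x2 \<notin> X" using X dir1 by auto
    then have "card (cut G X) \<le> 3" using card_eq[of X] X(10,11,14) 5 val1 by simp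
    then consider v where "X = {v}" | v where "verts G - X = {v}" using triv[OF X(2-4)] by blast
    then show False
    proof cases
      case 1
      then show False using u dist by auto
    next
      case (2 v)
      then have "y2 = v" "x2 = v" using single[OF 2] u V by auto
      then show False using dist by simp
    qed
  next
    case 6
    then have u: "v1 \<in> Y" "x1 \<notin> Y" "y1 \<notin> Y" using Y dir2 by auto
    then have "a \<notin> cut G Y" using Y by auto
    then have "card (cut G Y) \<le> 3" using card_le[of Y] Y(11) 6 val2 by simp
    then consider v where "Y = {v}" | v where "verts G - Y = {v}" using triv[OF Y(1-3)] by blast
    then show False
    proof cases
      case 1
      then have "Y = {v1}" using u by auto
      \<comment> \<open>As \<open>v1\<close> is not an end of \<open>c\<close>, neither
        \<open>a\<close> nor \<open>c\<close> crosses, and only two edges remain, against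
        \<open>conn\<close>.\<close>
      then have "c \<notin> cut G Y" using Y(9) nonadj by auto
      then show False using card_eq[OF \<open>a \<notin> cut G Y\<close>] Y(11) 6 val2 conn[rule_format, OF Y(1-3)] by simp
    next
      case (2 v)
      then have "x1 = v" "y1 = v" using single[OF 2] u V by auto
      then show False using dist by simp
    qed
  next
    case 7
    then have u: "x2 \<in> Y" "u2 \<notin> Y" "y2 \<in> Y" using Y dir2 by auto
    then have "c \<notin> cut G Y" using Y by auto
    then have "card (cut G Y) \<le> 3" using card_le[of Y] Y(11) 7 val2 by simp
    then consider v where "Y = {v}" | v where "verts G - Y = {v}" using triv[OF Y(1-3)] by blast
    then show False
    proof cases
      case 1
      then show False using u dist by auto
    next
      case (2 v)
      have "u2 \<in> verts G" using wf e 7 dir2(4) by (auto simp: wf_graph_def ohead_def split: if_splits)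
      then have "v = u2" using single[OF 2] u by simp
      then have "y1 \<in> Y" using single[OF 2 V(2)] nonadj by auto
      then have "a \<notin> cut G Y" using Y(8) by simp
      then show False using card_eq[OF _ \<open>c \<notin> cut G Y\<close>] Y(11) 7 val2 conn[rule_format, OF Y(1-3)] by simp
    qed
  next
    case 8
    then have u: "y1 \<in> Y" "w1 \<notin> Y" "x1 \<in> Y" using Y dir2 by auto
    then have "a \<notin> cut G Y" using Y by auto
    then have "card (cut G Y) \<le> 3" using card_le[of Y] Y(11) 8 val2 by simp
    then consider v where "Y = {v}" | v where "verts G - Y = {v}" using triv[OF Y(1-3)] by blast
    then show False
    proof cases
      case 1
      then show False using u dist by auto
    next
      case (2 v)
      have "w1 \<in> verts G" using wf e 8 dir2(6) by (auto simp: wf_graph_def ohead_def split: if_splits)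
      then have "v = w1" using single[OF 2] u by simp
      then have "x2 \<in> Y" using single[OF 2 V(4)] nonadj by auto
      then have "c \<notin> cut G Y" using Y(9) by simp
      then show False using card_eq[OF \<open>a \<notin> cut G Y\<close>] Y(11) 8 val2 conn[rule_format, OF Y(1-3)] by simp
    qed
  next
    case 9
    then have u: "w2 \<in> Y" "y2 \<notin> Y" "x2 \<notin> Y" using Y dir2 by auto
    then have "c \<notin> cut G Y" using Y by auto
    then have "card (cut G Y) \<le> 3" using card_le[of Y] Y(11) 9 val2 by simp
    then consider v where "Y = {v}" | v where "verts G - Y = {v}" using triv[OF Y(1-3)] by blast
    then show False
    proof cases
      case 1
      then have "Y = {w2}" using u by auto
      then have "a \<notin> cut G Y" using Y(8) nonadj by auto
      then show False using card_eq[OF _ \<open>c \<notin> cut G Y\<close>] Y(11) 9 val2 conn[rule_format, OF Y(1-3)] by simp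
    next
      case (2 v)
      then have "y2 = v" "x2 = v" using single[OF 2] u V by auto
      then show False using dist by simp
    qed
  qed
qed

section \<open>Maximum matchings in a 2-regular graph\<close>

lemma matching_degE:
  assumes "finite P" "matching G P" "v \<in> vset G P"
  shows "degE G P v = 1"
proof -
  obtain e where e: "e \<in> P" "v = src G e \<or> v = tgt G e" using assms(3) by (auto simp: vset_def)
  have uniq: "k = e" if "k \<in> P" "src G k = v \<or> tgt G k = v" for k
    using that e assms(2) unfolding matching_def by blast
  have ne: "src G e \<noteq> tgt G e" using assms(2) e(1) by (auto simp: matching_def)
  have "degE G P v = degE G {e} v"
  proof (rule degE_closed[symmetric])
    show "{e} \<subseteq> P" using e(1) by simp
    show "k \<in> {e}" if "k \<in> P" "incident G k v" for k
      using uniq[OF that(1)] that(2) unfolding incident_def by blast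
  qed
  also have "\<dots> = 1" using e(2) ne by (auto simp: degE_as_sum)
  finally show ?thesis .
qed

lemma matching_card_vset:
  assumes "finite P" "matching G P"
  shows "card (vset G P) = 2 * card P"
  using sum_degE_vset[OF assms(1), of G] matching_degE[OF assms] by simp

text \<open>An exchange on the circuit \<open>D\<close>: there \<open>M\<close> is replaced by
  \<open>P\<close>, which covers all of \<open>D\<close> outside \<open>S\<close>. If
  \<open>M\<close> missed \<open>v\<close>, its part on \<open>D\<close> would cover fewer vertices
  than \<open>P\<close>, and the exchange would enlarge the matching.\<close>

lemma max_matching_covers:
  assumes fin: "finite C" and reg: "\<forall>v\<in>vset G C. degE G C v = 2"
    and D: "circuit G D" "D \<subseteq> C"
    and M: "max_matching G A M" and A: "A = {e\<in>C. \<forall>s\<in>S. \<not> incident G e s}"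
    and P: "P \<subseteq> D" "matching G P" "vset G P = vset G D - S"
    and v: "v \<in> vset G D" "v \<notin> S"
  shows "\<exists>m\<in>M. incident G m v"
proof (rule ccontr)
  assume nc: "\<not> ?thesis"
  have MA: "M \<subseteq> A" "matching G M" and max: "\<And>M'. M' \<subseteq> A \<Longrightarrow> matching G M' \<Longrightarrow> card M' \<le> card M"
    using M by (auto simp: max_matching_def)
  have MC: "M \<subseteq> C" using MA(1) A by auto
  have PA: "P \<subseteq> A"
  proof
    fix e assume e: "e \<in> P"
    then have "src G e \<notin> S" "tgt G e \<notin> S" using P(3) by (auto simp: vset_def)
    then show "e \<in> A" using e P(1) D(2) by (auto simp: A incident_def)
  qed
  have finM: "finite M" "finite D" "finite P" using MC D(2) P(1) fin finite_subset by metis+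
  \<comment> \<open>Every edge of \<open>C\<close> at a vertex of \<open>D\<close> lies in
    \<open>D\<close>, so edges of \<open>M\<close> outside \<open>D\<close> cannot clash with
    \<open>P\<close>.\<close>
  have off: "src G e \<notin> vset G D" "tgt G e \<notin> vset G D" if "e \<in> M - D" for e
    using circuit_absorbs[OF fin reg D, of _ e] that MC by (auto simp: incident_def)
  have Pin: "src G e \<in> vset G D" "tgt G e \<in> vset G D" if "e \<in> P" for e
    using that P(1) by (auto simp: vset_def)
  let ?M = "(M - D) \<union> P"
  have cross: "{src G e, tgt G e} \<inter> {src G e', tgt G e'} = {}" if "e \<in> M - D" "e' \<in> P" for e e'
    using off[OF that(1)] Pin[OF that(2)] by auto
  have "matching G ?M"
    unfolding matching_def
  proof (intro conjI ballI impI)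
    fix e assume "e \<in> ?M"
    then show "src G e \<noteq> tgt G e" using MA(2) P(2) by (auto simp: matching_def)
  next
    fix e e' assume e: "e \<in> ?M" "e' \<in> ?M" "e \<noteq> e'"
    consider "e \<in> M - D" "e' \<in> M - D" | "e \<in> M - D" "e' \<in> P" | "e \<in> P" "e' \<in> M - D" | "e \<in> P" "e' \<in> P"
      using e by blast
    then show "{src G e, tgt G e} \<inter> {src G e', tgt G e'} = {}"
    proof cases
      case 1 then show ?thesis using MA(2) e(3) unfolding matching_def by blast
    next
      case 2 then show ?thesis by (rule cross)
    next
      case 3 then show ?thesis using cross[of e' e] by blast
    next
      case 4 then show ?thesis using P(2) e(3) unfolding matching_def by blast
    qed
  qed
  moreover have "?M \<subseteq> A" using MA(1) PA by blast
  ultimately have le: "card ?M \<le> card M" using max by blast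
  have "matching G (M \<inter> D)" using MA(2) by (auto simp: matching_def)
  then have "2 * card (M \<inter> D) = card (vset G (M \<inter> D))"
    using matching_card_vset[of "M \<inter> D" G] finM by simp
  also have "\<dots> < card (vset G P)"
  proof (rule psubset_card_mono)
    show "finite (vset G P)" using finM by (simp add: finite_vset)
    have "vset G (M \<inter> D) \<subseteq> vset G D - S"
      using MA(1) by (auto simp: A vset_def incident_def)
    moreover have "v \<notin> vset G (M \<inter> D)" using nc by (auto simp: vset_def incident_def)
    ultimately show "vset G (M \<inter> D) \<subset> vset G P" using v P(3) by blast
  qed
  also have "\<dots> = 2 * card P" using matching_card_vset[OF finM(3) P(2)] .
  finally have "card (M \<inter> D) < card P" by simp
  moreover have "card ?M = card (M - D) + card P"
    using finM P(1) by (intro card_Un_disjoint) auto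
  moreover have "card M = card (M - D) + card (M \<inter> D)"
    using card_Int_Diff[OF finM(1), of D] by simp
  ultimately show False using le by linarith
qed

section \<open>Traversing the circuits of a smooth orientation\<close>

definition out_edge :: "('v,'e) mgraph \<Rightarrow> ('e \<Rightarrow> bool) \<Rightarrow> 'e set \<Rightarrow> 'v \<Rightarrow> 'e" where
  "out_edge G ori C v = (THE e. e \<in> C \<and> otail G ori e = v)"

definition succ_v :: "('v,'e) mgraph \<Rightarrow> ('e \<Rightarrow> bool) \<Rightarrow> 'e set \<Rightarrow> 'v \<Rightarrow> 'v" where
  "succ_v G ori C v = ohead G ori (out_edge G ori C v)"

lemma card_1_unique: "card {e\<in>S. f e = v} = 1 \<Longrightarrow> e \<in> S \<Longrightarrow> f e = v \<Longrightarrow> e' \<in> S \<Longrightarrow> f e' = v \<Longrightarrow> e = e'"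
  by (metis (mono_tags, lifting) card_1_singletonE mem_Collect_eq singletonD)

context
  fixes G :: "('v,'e) mgraph" and C :: "'e set" and ori :: "'e \<Rightarrow> bool"
  assumes fin: "finite C" and sub: "C \<subseteq> edges G"
    and reg: "\<forall>v\<in>vset G C. degE G C v = 2" and smooth: "smooth_orient G ori C"
begin

lemma out_edge_eq:
  assumes "e \<in> C"
  shows "out_edge G ori C (otail G ori e) = e"
proof -
  have "otail G ori e \<in> vset G C" using assms by (auto simp: vset_def otail_def)
  note one = smooth_orient_in_out(2)[OF fin sub reg smooth this]
  show ?thesis
    unfolding out_edge_def by (rule the_equality) (use assms card_1_unique[OF one] in auto)
qed

lemma in_edge_unique:
  assumes "e \<in> C" "e' \<in> C" "ohead G ori e = ohead G ori e'"
  shows "e = e'"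
proof -
  have "ohead G ori e \<in> vset G C" using assms by (auto simp: vset_def ohead_def)
  from smooth_orient_in_out(1)[OF fin sub reg smooth this] show ?thesis
    using assms card_1_unique[where f = "ohead G ori"] by metis
qed

lemma out_edge:
  assumes "v \<in> vset G C"
  shows "out_edge G ori C v \<in> C" "otail G ori (out_edge G ori C v) = v"
proof -
  obtain e where "e \<in> C" "otail G ori e = v"
    using smooth_orient_in_out(2)[OF fin sub reg smooth assms] by (auto simp: card_1_singleton_iff)
  then show "out_edge G ori C v \<in> C" "otail G ori (out_edge G ori C v) = v"
    using out_edge_eq by auto
qed

lemma succ_v_eq: "e \<in> C \<Longrightarrow> succ_v G ori C (otail G ori e) = ohead G ori e"
  by (simp add: succ_v_def out_edge_eq)

text \<open>The successor map is injective on the vertices of \<open>D\<close>, so the orbit of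
  \<open>y\<close> first repeats at \<open>y\<close> itself. It is closed under successors and
  predecessors, so by connectedness it is all of \<open>D\<close>; its period is
  \<open>card D\<close>, as a circuit has as many vertices as edges.\<close>

lemma circuit_orbit:
  assumes D: "circuit G D" "D \<subseteq> C" and y: "y \<in> vset G D"
  shows "inj_on (\<lambda>i. (succ_v G ori C ^^ i) y) {..<card D}"
    and "(\<lambda>i. (succ_v G ori C ^^ i) y) ` {..<card D} = vset G D"
proof -
  let ?s = "succ_v G ori C"
  have DC: "vset G D \<subseteq> vset G C" using D(2) by (auto simp: vset_def)
  have finD: "finite D" using D(2) fin finite_subset by blast
  have outD: "out_edge G ori C v \<in> D" if "v \<in> vset G D" for v
    using circuit_absorbs[OF fin reg D that] out_edge[of v] that DC
    by (auto simp: incident_def otail_def split: if_splits)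
  have s_in: "?s v \<in> vset G D" if "v \<in> vset G D" for v
    using outD[OF that] by (auto simp: succ_v_def vset_def ohead_def)
  have s_inj: "v = w" if "v \<in> vset G D" "w \<in> vset G D" "?s v = ?s w" for v w
  proof -
    have vw: "v \<in> vset G C" "w \<in> vset G C" using that(1,2) DC by (blast, blast)
    then have "out_edge G ori C v = out_edge G ori C w"
      using in_edge_unique[OF out_edge(1)[OF vw(1)] out_edge(1)[OF vw(2)]] that(3) by (simp add: succ_v_def)
    then show ?thesis using out_edge(2)[OF vw(1)] out_edge(2)[OF vw(2)] by metis
  qed
  define r where "r i = (?s ^^ i) y" for i
  have r_in: "r i \<in> vset G D" for i
    by (induction i) (auto simp: r_def y s_in)
  have r_Suc: "r (Suc i) = ?s (r i)" for i by (simp add: r_def)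
  have cancel: "r k = y" if "r (i + k) = r i" for i k
    using that
  proof (induction i)
    case 0 then show ?case by (simp add: r_def)
  next
    case (Suc i)
    then have "?s (r (i + k)) = ?s (r i)" by (simp add: r_Suc)
    then have "r (i + k) = r i" using s_inj r_in by blast
    then show ?case by (rule Suc.IH)
  qed
  have "\<not> inj r"
    using finite_subset[of "range r" "vset G D"] finite_vset[OF finD] r_in finite_imageD[of r UNIV] by auto
  then obtain i j where ij: "i < j" "r i = r j" by (metis injI linorder_neqE_nat)
  then have per: "r (j - i) = y" "0 < j - i" using cancel[of i "j - i"] by auto
  define n where "n = (LEAST n. 0 < n \<and> r n = y)"
  have n: "0 < n" "r n = y" and n_min: "\<And>k. 0 < k \<Longrightarrow> r k = y \<Longrightarrow> n \<le> k"
    using LeastI[of "\<lambda>n. 0 < n \<and> r n = y" "j - i"] per Least_le[of "\<lambda>n. 0 < n \<and> r n = y"]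
    by (auto simp: n_def)
  have ne: "r i \<noteq> r j" if "i < j" "j < n" for i j
  proof
    assume "r i = r j"
    then have "r (j - i) = y" using cancel[of i "j - i"] that by simp
    then show False using n_min[of "j - i"] that by simp
  qed
  have inj: "inj_on r {..<n}"
    by (rule inj_onI) (metis lessThan_iff linorder_neqE_nat ne)
  let ?R = "r ` {..<n}"
  have pred: "\<exists>k\<in>?R. ?s k = p" if p: "p \<in> ?R" for p
  proof -
    obtain i where i: "i < n" "p = r i" using p by auto
    show ?thesis
    proof (cases i)
      case 0
      then have "p = ?s (r (n - 1))" using i n r_Suc[of "n - 1"] by (simp add: r_def)
      then show ?thesis using n by auto
    next
      case (Suc k)
      then show ?thesis using i r_Suc[of k] by (intro bexI[of _ "r k"]) auto
    qed
  qed
  have suc: "?s p \<in> ?R" if p: "p \<in> ?R" for p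
  proof -
    obtain i where i: "i < n" "p = r i" using p by auto
    show ?thesis
    proof (cases "Suc i = n")
      case True
      then have "?s p = r 0" using i r_Suc[of i] n by (simp add: r_def)
      then show ?thesis using n by auto
    next
      case False
      then have "Suc i < n" using i by simp
      then show ?thesis using i r_Suc[of i] by (metis imageI lessThan_iff)
    qed
  qed
  have "w \<in> ?R" if "(y, w) \<in> (adjrel G D)\<^sup>*" for w
    using that
  proof (induction rule: rtrancl_induct)
    case base
    have "y = r 0" by (simp add: r_def)
    then show ?case using n by auto
  next
    case (step p q)
    then obtain e where e: "e \<in> D" "joins G e p q" by (auto simp: adjrel_def)
    then have eC: "e \<in> C" using D(2) by blast
    consider "otail G ori e = p" "ohead G ori e = q" | "otail G ori e = q" "ohead G ori e = p"
      using e(2) by (cases "ori e") (auto simp: joins_def otail_def ohead_def)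
    then show ?case
    proof cases
      case 1
      then show ?thesis using succ_v_eq[OF eC] suc[OF step.IH] by simp
    next
      case 2
      obtain k where k: "k \<in> ?R" "?s k = p" using pred[OF step.IH] by blast
      have "q \<in> vset G D" "k \<in> vset G D"
        using e(1) 2 k r_in by (auto simp: vset_def otail_def)
      moreover have "?s q = p" using succ_v_eq[OF eC] 2 by simp
      ultimately show ?thesis using s_inj k by metis
    qed
  qed
  then have RD: "?R = vset G D" using D(1) y r_in by (auto simp: circuit_def)
  have "2 * card (vset G D) = 2 * card D"
    using sum_degE_vset[OF finD, of G] D(1) by (simp add: circuit_def)
  then have "n = card D" using RD card_image[OF inj] by simp
  then show "inj_on (\<lambda>i. (?s ^^ i) y) {..<card D}" "(\<lambda>i. (?s ^^ i) y) ` {..<card D} = vset G D"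
    using inj RD by (simp_all add: r_def[abs_def])
qed

text \<open>The vertices of \<open>S\<close> on the circuit are \<open>t\<close> consecutive ones; the rest is a path with
  \<open>card D - t\<close> vertices, matched along its odd edges.\<close>
lemma circuit_matching:
  assumes D: "circuit G D" "D \<subseteq> C" and y: "y \<in> vset G D" and t: "t \<le> card D" "even (card D - t)"
    and S: "S \<inter> vset G D = (\<lambda>i. (succ_v G ori C ^^ i) y) ` {..<t}"
  obtains P where "P \<subseteq> D" "matching G P" "vset G P = vset G D - S"
proof -
  define n where "n = card D"
  define r where "r i = (succ_v G ori C ^^ i) y" for i
  have inj: "inj_on r {..<n}" and img: "r ` {..<n} = vset G D"
    using circuit_orbit[OF D y] by (simp_all add: r_def[abs_def] n_def)
  have Sr: "S \<inter> vset G D = r ` {..<t}" using S by (simp add: r_def)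
  have DC: "vset G D \<subseteq> vset G C" using D(2) by (auto simp: vset_def)
  define I where "I = {i. t \<le> i \<and> i < n \<and> even (i - t)}"
  define \<epsilon> where "\<epsilon> i = out_edge G ori C (r i)" for i
  \<comment> \<open>Parity keeps the last chosen edge from running from position
    \<open>n - 1\<close> back to position 0.\<close>
  have I_Suc: "Suc i < n" if "i \<in> I" for i
  proof -
    have "even (n - t)" "even (i - t)" "t \<le> i" "i < n" using that t by (auto simp: I_def n_def)
    then have "Suc i \<noteq> n" by (metis Suc_diff_le even_Suc)
    then show ?thesis using \<open>i < n\<close> by simp
  qed
  have r_in: "r i \<in> vset G D" if "i < n" for i using that img by auto
  have \<epsilon>: "\<epsilon> i \<in> C" "otail G ori (\<epsilon> i) = r i" "ohead G ori (\<epsilon> i) = r (Suc i)" if "i < n" for i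
    using out_edge[of "r i"] r_in[OF that] DC by (auto simp: \<epsilon>_def r_def succ_v_def)
  have ends: "{src G (\<epsilon> i), tgt G (\<epsilon> i)} = {r i, r (Suc i)}" if "i < n" for i
    using \<epsilon>(2,3)[OF that] by (auto simp: otail_def ohead_def split: if_splits)
  have "\<epsilon> i \<in> D" if "i \<in> I" for i
    using that circuit_absorbs[OF fin reg D r_in, of i "\<epsilon> i"] \<epsilon>[of i]
    by (auto simp: I_def incident_def otail_def split: if_splits)
  then have sub: "\<epsilon> ` I \<subseteq> D" by blast
  have r_eq: "i = j" if "r i = r j" "i < n" "j < n" for i j
    using inj that by (auto simp: inj_on_def)
  have "matching G (\<epsilon> ` I)"
    unfolding matching_def
  proof (intro conjI ballI impI)
    fix e assume "e \<in> \<epsilon> ` I"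
    then obtain i where i: "i \<in> I" "e = \<epsilon> i" by blast
    have "r i \<noteq> r (Suc i)" using r_eq[of i "Suc i"] I_Suc[OF i(1)] by auto
    then show "src G e \<noteq> tgt G e" using ends[of i] I_Suc[OF i(1)] i(2) by (auto simp: doubleton_eq_iff)
  next
    fix e e' assume "e \<in> \<epsilon> ` I" "e' \<in> \<epsilon> ` I" "e \<noteq> e'"
    then obtain i j where ij: "i \<in> I" "e = \<epsilon> i" "j \<in> I" "e' = \<epsilon> j" "i \<noteq> j" by blast
    have par: "i \<noteq> Suc j" "j \<noteq> Suc i" using ij(1,3) by (auto simp: I_def Suc_diff_le)
    have "{r i, r (Suc i)} \<inter> {r j, r (Suc j)} = {}"
      using r_eq[of i j] r_eq[of i "Suc j"] r_eq[of "Suc i" j] r_eq[of "Suc i" "Suc j"] par ij(5)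
        I_Suc[OF ij(1)] I_Suc[OF ij(3)] by auto
    then show "{src G e, tgt G e} \<inter> {src G e', tgt G e'} = {}"
      using ends[of i] ends[of j] I_Suc[OF ij(1)] I_Suc[OF ij(3)] ij(2,4) by simp
  qed
  moreover have "vset G (\<epsilon> ` I) = vset G D - S"
  proof -
    have "vset G (\<epsilon> ` I) = (\<Union>i\<in>I. {r i, r (Suc i)})"
    proof -
      have "{src G (\<epsilon> i), tgt G (\<epsilon> i)} = {r i, r (Suc i)}" if "i \<in> I" for i
        using ends[of i] I_Suc[OF that] by simp
      then show ?thesis by (simp add: vset_def)
    qed
    also have "\<dots> = r ` {t..<n}"
    proof
      show "(\<Union>i\<in>I. {r i, r (Suc i)}) \<subseteq> r ` {t..<n}"
        using I_Suc by (auto simp: I_def)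
      show "r ` {t..<n} \<subseteq> (\<Union>i\<in>I. {r i, r (Suc i)})"
      proof
        fix p assume "p \<in> r ` {t..<n}"
        then obtain i where i: "t \<le> i" "i < n" "p = r i" by auto
        show "p \<in> (\<Union>i\<in>I. {r i, r (Suc i)})"
        proof (cases "even (i - t)")
          case True
          then show ?thesis using i by (auto simp: I_def)
        next
          case False
          \<comment> \<open>A position at odd distance from \<open>t\<close> is the head of the
            chosen edge starting one place earlier.\<close>
          then have "i \<noteq> t" "i \<noteq> 0" by (auto intro: Nat.gr0I)
          then have "i - 1 \<in> I" "i = Suc (i - 1)" using False i by (auto simp: I_def)
          then show ?thesis using i(3) by (metis UN_I insertCI)
        qed
      qed
    qed
    also have "\<dots> = r ` {..<n} - r ` {..<t}"
    proof -
      have eq: "{t..<n} = {..<n} - {..<t}" by auto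
      have "{..<n} - {..<t} \<subseteq> {..<n}" "{..<t} \<subseteq> {..<n}" using t by (auto simp: n_def)
      then show ?thesis unfolding eq by (rule inj_on_image_set_diff[OF inj])
    qed
    also have "\<dots> = vset G D - S" using Sr img by auto
    finally show ?thesis .
  qed
  ultimately show ?thesis using that[OF sub] by blast
qed

end

section \<open>Frank number 2\<close>

lemma degE_Un_disjoint:
  assumes "finite A" "finite B" "A \<inter> B = {}"
  shows "degE G (A \<union> B) v = degE G A v + degE G B v"
  using assms by (simp add: degE_as_sum sum.union_disjoint)

lemma card_incident_le_degE:
  assumes "finite D"
  shows "card {e\<in>D. incident G e v} \<le> degE G D v"
proof -
  have "{e\<in>D. incident G e v} = {e\<in>D. src G e = v} \<union> {e\<in>D. tgt G e = v}"
    by (auto simp: incident_def)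
  then show ?thesis by (simp add: degE_def card_Un_le)
qed

text \<open>A cut of fewer than four edges has an acyclic side \<open>Y\<close>, and
  \<open>card Y + 2\<close> is at most the cut size: a nonempty \<open>Y\<close> gives 3, and size 3
  leaves only \<open>card Y = 1\<close>.\<close>

lemma cyc4_cuts:
  assumes "cubic G" "cyc_edge_conn G 4" "X \<subseteq> verts G" "X \<noteq> {}" "X \<noteq> verts G"
  shows "3 \<le> card (cut G X)"
    and "card (cut G X) \<le> 3 \<Longrightarrow> \<exists>v. X = {v} \<or> verts G - X = {v}"
proof -
  have Y: "\<exists>Y. (Y = X \<or> Y = verts G - X) \<and> card Y + 2 \<le> card (cut G X) \<and> card Y > 0"
    if "card (cut G X) < 4"
    by (rule cyc_conn_cut[OF assms that]) (use card_gt_0_iff in blast)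
  show "3 \<le> card (cut G X)"
  proof (rule ccontr)
    assume "\<not> ?thesis"
    then show False using Y by linarith
  qed
  assume "card (cut G X) \<le> 3"
  then obtain Y where Y: "Y = X \<or> Y = verts G - X" "card Y = 1" using Y by force
  then show "\<exists>v. X = {v} \<or> verts G - X = {v}" by (metis card_1_singletonE)
qed

theorem theorem4:
  fixes G :: "('v, 'e) mgraph"
    and C N1 N2 W M :: "'e set"
    and x1 y1 y2 x2 u1 v1 u2 v2 w1 w2 :: 'v
    and a b c f1 g1 f2 g2 h1 h2 :: 'e
  assumes cubic: "cubic G"
    and cc4: "cyc_edge_conn G 4"
    and twoF: "two_factor G C"
    and odds: "{D. circuit G D \<and> D \<subseteq> C \<and> odd (card D)} = {N1, N2}"
    and N12: "N1 \<noteq> N2"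
    and W: "circuit G W" "W \<subseteq> C" "even (card W)"
    and a: "a \<in> edges G" "joins G a x1 y1"
    and b: "b \<in> edges G" "joins G b y1 y2"
    and c: "c \<in> edges G" "joins G c y2 x2"
    and xy: "x1 \<in> vset G N1" "x2 \<in> vset G N2" "y1 \<in> vset G W" "y2 \<in> vset G W"
    and uv1: "f1 \<in> N1" "g1 \<in> N1" "f1 \<noteq> g1" "joins G f1 x1 u1" "joins G g1 x1 v1"
    and uv2: "f2 \<in> N2" "g2 \<in> N2" "f2 \<noteq> g2" "joins G f2 x2 u2" "joins G g2 x2 v2"
    and w1: "h1 \<in> W" "h1 \<noteq> b" "joins G h1 y1 w1"
    and w2: "h2 \<in> W" "h2 \<noteq> b" "joins G h2 y2 w2"
    and M: "max_matching G {e\<in>C. \<not> incident G e x1 \<and> \<not> incident G e y1 \<and>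
                                  \<not> incident G e y2 \<and> \<not> incident G e x2} M"
    and i: "\<exists>o1 o2. smooth_orient G o1 (((edges G - C) - {a, c}) \<union> M) \<and> smooth_orient G o2 C \<and>
            (\<forall>e \<in> {e\<in>N1. \<not> incident G e x1 \<and> (incident G e u1 \<or> incident G e v1)}
                 \<union> {e\<in>N2. \<not> incident G e x2 \<and> (incident G e u2 \<or> incident G e v2)}
                 \<union> {e\<in>W. (incident G e w1 \<or> incident G e w2) \<and>
                          \<not> incident G e y1 \<and> \<not> incident G e y2}.
               o1 e = o2 e)"
    and ii: "cyc_edge_conn (smooth2 G a c) 3"
    and iii: "\<not> (\<exists>X e1 e2 e3. cycle_separating (smooth2 G a c) X \<and>
                 cut (smooth2 G a c) X = {e1, e2, e3} \<and> card {e1, e2, e3} = 3 \<and>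
                 e1 \<in> edges (smooth2 G a c) - Inl ` edges G \<and>
                 e2 \<in> Inl ` (((edges G - C) - {a, c}) \<union> M) \<and>
                 e3 \<in> Inl ` (((edges G - C) - {a, c}) \<union> M))"
  shows "fn G = 2"
proof -
  let ?V = "verts G" and ?E = "edges G" and ?S = "{x1, y1, y2, x2}"
  have wf: "wf_graph G" using cubic by (simp add: cubic_def)
  then have fin: "finite ?E" and ends_V: "\<And>e. e \<in> ?E \<Longrightarrow> src G e \<in> ?V \<and> tgt G e \<in> ?V"
    by (auto simp: wf_graph_def)
  note conn = cyc4_cuts(1)[OF cubic cc4] and triv = cyc4_cuts(2)[OF cubic cc4]
  have CE: "C \<subseteq> ?E" using twoF by (simp add: two_factor_def)
  then have finC: "finite C" using fin finite_subset by blast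
  have vC: "vset G C \<subseteq> ?V" using CE ends_V by (auto simp: vset_def)
  have regV: "degE G C v = 2" if "v \<in> ?V" for v using twoF that by (simp add: two_factor_def)
  have reg: "\<forall>v\<in>vset G C. degE G C v = 2" using regV vC by blast
  have VC: "v \<in> vset G C" if "v \<in> ?V" for v
    using regV[OF that] degE_pos_iff[OF finC, of G v] by simp
  have N: "circuit G N1" "N1 \<subseteq> C" "odd (card N1)" "circuit G N2" "N2 \<subseteq> C" "odd (card N2)"
    using odds by blast+
  note absorb = circuit_absorbs[OF finC reg] and meet = circuit_eq_if_meet[OF finC reg]
  \<comment> \<open>Circuits of \<open>C\<close> sharing a vertex coincide; parity tells
    \<open>N1\<close> from \<open>W\<close>.\<close>
  have N1W: "v \<notin> vset G W" if "v \<in> vset G N1" for v using meet[OF N(1,2) W(1,2) that] N(3) W(3) by auto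
  have N2W: "v \<notin> vset G W" if "v \<in> vset G N2" for v using meet[OF N(4,5) W(1,2) that] N(6) W(3) by auto
  have N1N2: "v \<notin> vset G N2" if "v \<in> vset G N1" for v using meet[OF N(1,2,4,5) that] N12 by auto
  have joins_ends: "src G e = p \<and> tgt G e = q \<or> src G e = q \<and> tgt G e = p" if "joins G e p q" for e p q
    using that by (auto simp: joins_def)
  have joins_inc: "incident G e p" "incident G e q" if "joins G e p q" for e p q
    using joins_ends[OF that] by (auto simp: incident_def)
  have xV: "x1 \<in> ?V" "y1 \<in> ?V" "y2 \<in> ?V" "x2 \<in> ?V"
    using joins_ends[OF a(2)] joins_ends[OF c(2)] ends_V a(1) c(1) by metis+
  \<comment> \<open>A loop uses two of the three edge ends at \<open>v\<close>, leaving at most one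
    cut edge, while at least three are needed.\<close>
  have noloop: "src G e \<noteq> tgt G e" if e: "e \<in> ?E" for e
  proof
    assume loop: "src G e = tgt G e"
    define v where "v = src G e"
    have v: "v \<in> ?V" using ends_V e by (simp add: v_def)
    have "{v} \<noteq> ?V" using xV xy N1W[OF xy(1)] by (metis singletonD)
    then have "3 \<le> card (cut G {v})" using conn v by auto
    also have "\<dots> \<le> degE G (?E - {e}) v"
    proof -
      have "card (cut G {v}) \<le> card {k\<in>?E - {e}. incident G k v}"
        using fin loop by (intro card_mono) (auto simp: cut_def incident_def)
      then show ?thesis using card_incident_le_degE[of "?E - {e}" G v] fin by simp
    qed
    finally have "3 + degE G {e} v \<le> degE G ?E v"
      using degE_Un_disjoint[of "?E - {e}" "{e}" G v] fin e by (simp add: insert_absorb)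
    then show False using cubic v loop by (simp add: cubic_def degE_as_sum v_def)
  qed
  have joins_ne: "p \<noteq> q" if "joins G e p q" "e \<in> ?E" for e p q
    using joins_ends[OF that(1)] noloop[OF that(2)] by auto
  have dist: "distinct [x1, y1, y2, x2]"
    using N1W[OF xy(1)] N2W[OF xy(2)] N1N2[OF xy(1)] xy joins_ne[OF b(2,1)] by auto
  have inE: "f1 \<in> C" "g1 \<in> C" "f2 \<in> C" "g2 \<in> C" "h1 \<in> C" "h2 \<in> C"
    using uv1 uv2 w1 w2 N W by auto
  have in_vset: "p \<in> vset G D" if "e \<in> D" "incident G e p" for e p D
    using that by (auto simp: vset_def incident_def)
  \<comment> \<open>If \<open>a\<close> were in \<open>C\<close>, it would lie on \<open>N1\<close>
    and put \<open>y1\<close> on \<open>N1\<close> as well as on \<open>W\<close>.\<close>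
  have aC: "a \<notin> C"
    using absorb[OF N(1,2) xy(1), of a] in_vset[of a N1 y1] joins_inc[OF a(2)] N1W[of y1] xy by blast
  have cC: "c \<notin> C"
    using absorb[OF N(4,5) xy(2), of c] in_vset[of c N2 y2] joins_inc[OF c(2)] N2W[of y2] xy by blast
  have ac: "a \<noteq> c" using joins_ends[OF a(2)] joins_ends[OF c(2)] dist by auto
  \<comment> \<open>Cubic minus 2-regular: \<open>F\<close> is a perfect matching.\<close>
  have degF: "degE G (?E - C) v = 1" if "v \<in> ?V" for v
  proof -
    have "(?E - C) \<inter> C = {}" by blast
    then show ?thesis
      using degE_Un_disjoint[of "?E - C" C G v] finC fin CE regV[OF that] cubic that
      by (simp add: cubic_def Un_absorb2)
  qed
  have F_unique: "e = e'" if "e \<in> ?E - C" "e' \<in> ?E - C" "incident G e v" "incident G e' v" "v \<in> ?V" for e e' v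
  proof -
    have "card {k\<in>?E - C. incident G k v} \<le> Suc 0"
      using card_incident_le_degE[of "?E - C" G v] fin degF[OF that(5)] by simp
    then show ?thesis using that fin by (subst (asm) card_le_Suc0_iff_eq) auto
  qed
  have C_two: "k \<in> {e, e'}" if "e \<in> C" "e' \<in> C" "e \<noteq> e'" "incident G e v" "incident G e' v" "v \<in> ?V"
    "k \<in> C" "incident G k v" for e e' k v
  proof -
    have "card {k\<in>C. incident G k v} \<le> card {e, e'}"
      using card_incident_le_degE[OF finC, of G v] regV[OF that(6)] that(3) by simp
    then have "{e, e'} = {k\<in>C. incident G k v}"
      using that finC by (intro card_seteq) auto
    then show ?thesis using that by blast
  qed
  \<comment> \<open>The only edge of \<open>F\<close> at \<open>y1\<close> is
    \<open>a\<close>.\<close>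
  have bC: "b \<in> C"
  proof (rule ccontr)
    assume "b \<notin> C"
    then have "a = b"
      using F_unique[of a b y1] a b aC joins_inc[OF a(2)] joins_inc[OF b(2)] xV by blast
    then show False using joins_ends[OF a(2)] joins_ends[OF b(2)] dist by auto
  qed
  have at_x1: "k \<in> {f1, g1, a}" if "k \<in> ?E" "incident G k x1" for k
    using C_two[of f1 g1 x1 k] F_unique[of k a x1] that inE uv1 joins_inc a aC xV by blast
  have at_x2: "k \<in> {f2, g2, c}" if "k \<in> ?E" "incident G k x2" for k
    using C_two[of f2 g2 x2 k] F_unique[of k c x2] that inE uv2 joins_inc c cC xV by blast
  have at_y1: "k \<in> {h1, b, a}" if "k \<in> ?E" "incident G k y1" for k
    using C_two[of h1 b y1 k] F_unique[of k a y1] that inE bC w1 joins_inc b a aC xV by blast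
  have at_y2: "k \<in> {h2, b, c}" if "k \<in> ?E" "incident G k y2" for k
    using C_two[of h2 b y2 k] F_unique[of k c y2] that inE bC w2 joins_inc b c cC xV by blast
  \<comment> \<open>Otherwise \<open>h1\<close> and \<open>b\<close> are parallel, and only
    \<open>a\<close> and \<open>c\<close> leave \<open>{y1, y2}\<close>.\<close>
  have no_par: "h1 \<noteq> h2"
  proof
    assume h: "h1 = h2"
    have j: "joins G h1 y1 y2"
      using joins_ends[OF w1(3)] joins_ends[OF w2(3)] h dist noloop inE CE by (auto simp: joins_def prod_eq_iff)
    have sub: "cut G {y1, y2} \<subseteq> {a, c}"
    proof
      fix k assume k: "k \<in> cut G {y1, y2}"
      then have "incident G k y1 \<or> incident G k y2" "k \<in> ?E" by (auto simp: cut_def incident_def)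
      then have "k \<in> {h1, b, a, c}" using at_y1 at_y2 h by blast
      moreover have "k \<noteq> h1" "k \<noteq> b"
        using k joins_ends[OF j] joins_ends[OF b(2)] by (auto simp: cut_def)
      ultimately show "k \<in> {a, c}" by blast
    qed
    then have "card (cut G {y1, y2}) \<le> card {a, c}" by (intro card_mono) auto
    also have "\<dots> \<le> 2" by (simp add: card_insert_if)
    finally have "card (cut G {y1, y2}) \<le> 2" .
    moreover have "3 \<le> card (cut G {y1, y2})"
      by (rule conn) (use xV dist in auto)
    ultimately show False by simp
  qed
  have w1_ne: "w1 \<noteq> y2"
    using at_y2[of h1] w1 joins_inc[OF w1(3)] inE CE no_par cC by auto
  have w2_ne: "w2 \<noteq> y1"
    using at_y1[of h2] w2 joins_inc[OF w2(3)] inE CE no_par aC by auto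
  have circ_ends: "p \<in> vset G D" "q \<in> vset G D" if "joins G e p q" "e \<in> D" for e p q D
    using in_vset[OF that(2)] joins_inc[OF that(1)] by auto
  have u1S: "u1 \<notin> ?S" "v1 \<notin> ?S"
    using circ_ends[OF uv1(4,1)] circ_ends[OF uv1(5,2)] N1W N1N2 xy
      joins_ne[OF uv1(4)] joins_ne[OF uv1(5)] inE CE by auto
  have u2S: "u2 \<notin> ?S" "v2 \<notin> ?S"
    using circ_ends[OF uv2(4,1)] circ_ends[OF uv2(5,2)] N2W N1N2 xy
      joins_ne[OF uv2(4)] joins_ne[OF uv2(5)] inE CE by auto
  have w1S: "w1 \<notin> ?S" "w2 \<notin> ?S"
    using circ_ends[OF w1(3,1)] circ_ends[OF w2(3,1)] N1W N2W xy w1_ne w2_ne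
      joins_ne[OF w1(3)] joins_ne[OF w2(3)] inE CE by auto
  have S_edges: "e \<in> {a, b, c}" if e: "e \<in> ?E" "src G e \<in> ?S" "tgt G e \<in> ?S" for e
  proof -
    have "incident G e x1 \<or> incident G e y1 \<or> incident G e y2 \<or> incident G e x2"
      using e(2) by (auto simp: incident_def)
    then have "e \<in> {a, b, c, f1, g1, f2, g2, h1, h2}" using at_x1 at_x2 at_y1 at_y2 e(1) by blast
    moreover have "e \<noteq> f1" "e \<noteq> g1" "e \<noteq> f2" "e \<noteq> g2" "e \<noteq> h1" "e \<noteq> h2"
      using e(2,3) joins_ends[OF uv1(4)] joins_ends[OF uv1(5)] joins_ends[OF uv2(4)] joins_ends[OF uv2(5)]
        joins_ends[OF w1(3)] joins_ends[OF w2(3)] u1S u2S w1S by metis+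
    ultimately show ?thesis by blast
  qed
  let ?sp = "{a, c, b, f1, g1, f2, g2, h1, h2}"
  have off_S: "\<not> incident G e v" if "e \<in> ?E" "e \<notin> ?sp" "v \<in> ?S" for e v
    using that at_x1[of e] at_x2[of e] at_y1[of e] at_y2[of e] by auto
  have off: "3 \<le> card (cut G X - {a, c})" if X: "X \<subseteq> ?V" "e \<in> cut G X" "e \<notin> ?sp" for X e
  proof (rule smooth2_cut[OF cubic ii a c dist _ noloop[OF b(1)] X(1,2)])
    show "k \<in> {a, b, c}" if "k \<in> ?E" "src G k \<in> ?S" "tgt G k \<in> ?S" for k
      using S_edges that by blast
    show "\<not> incident G e v" if "v \<in> ?S" for v
      using off_S[of e v] X(2,3) that by (simp add: cut_def)
  qed
  obtain o1 o2 where o1: "smooth_orient G o1 (((?E - C) - {a, c}) \<union> M)" and o2: "smooth_orient G o2 C"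
    and agree: "\<forall>e \<in> {e\<in>N1. \<not> incident G e x1 \<and> (incident G e u1 \<or> incident G e v1)}
                 \<union> {e\<in>N2. \<not> incident G e x2 \<and> (incident G e u2 \<or> incident G e v2)}
                 \<union> {e\<in>W. (incident G e w1 \<or> incident G e w2) \<and>
                          \<not> incident G e y1 \<and> \<not> incident G e y2}.
               o1 e = o2 e"
    using i by blast
  let ?s = "succ_v G o2 C"
  note succ_eq = succ_v_eq[OF finC CE reg o2]
  have b_dir: "otail G o2 b = y1 \<and> ohead G o2 b = y2 \<or> otail G o2 b = y2 \<and> ohead G o2 b = y1"
    using joins_ends[OF b(2)] by (auto simp: otail_def ohead_def)
  have M_C: "M \<subseteq> C" and M_S: "\<And>e v. e \<in> M \<Longrightarrow> v \<in> ?S \<Longrightarrow> \<not> incident G e v" and M_m: "matching G M"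
    using M by (auto simp: max_matching_def)
  have finM: "finite M" using M_C finC finite_subset by blast
  have M_edges: "{e\<in>C. \<not> incident G e x1 \<and> \<not> incident G e y1 \<and> \<not> incident G e y2 \<and> \<not> incident G e x2}
      = {e\<in>C. \<forall>s\<in>?S. \<not> incident G e s}" by auto
  have cover: "\<exists>m\<in>M. incident G m v" if v: "v \<in> ?V" "v \<notin> ?S" for v
  proof -
    define D where "D = comp_edges G C v"
    have D: "circuit G D" "v \<in> vset G D" "D \<subseteq> C"
      using comp_edges_circuit[OF finC CE reg VC[OF v(1)]] by (auto simp: D_def comp_edges_def)
    have finD: "finite D" using D(3) finC finite_subset by blast
    have pos: "card D > 0" using D(1) finD by (simp add: card_gt_0_iff circuit_def)
    \<comment> \<open>On each circuit the vertices of \<open>?S\<close> are \<open>t\<close>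
      consecutive ones: one on \<open>N1\<close> and on \<open>N2\<close>, two on \<open>W\<close>,
      none elsewhere. In every case an even number of vertices remains.\<close>
    have "\<exists>y t. y \<in> vset G D \<and> t \<le> card D \<and> even (card D - t) \<and> ?S \<inter> vset G D = (\<lambda>i. (?s ^^ i) y) ` {..<t}"
    proof (cases "?S \<inter> vset G D = {}")
      case True
      then have "D \<noteq> N1" "D \<noteq> N2" using xy by auto
      then have "even (card D)" using odds D(1,3) by blast
      then show ?thesis using True D(2) by (intro exI[of _ v] exI[of _ 0]) simp
    next
      case False
      then obtain s where s: "s \<in> ?S" "s \<in> vset G D" by blast
      have one: "{..<1::nat} = {0}" and two: "{..<2::nat} = {0, 1}" by auto
      consider "D = N1" | "D = N2" | "D = W"
        using meet[OF D(1,3) N(1,2) s(2)] meet[OF D(1,3) N(4,5) s(2)] meet[OF D(1,3) W(1,2) s(2)] s(1) xy by auto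
      then show ?thesis
      proof cases
        case 1
        then have "?S \<inter> vset G D = {x1}" using xy N1W N1N2 by auto
        then show ?thesis using 1 N(3) xy pos
          by (intro exI[of _ x1] exI[of _ 1]) (auto simp: one)
      next
        case 2
        then have "?S \<inter> vset G D = {x2}" using xy N2W N1N2 by auto
        then show ?thesis using 2 N(6) xy pos
          by (intro exI[of _ x2] exI[of _ 1]) (auto simp: one)
      next
        case 3
        then have SD: "?S \<inter> vset G D = {y1, y2}" using xy N1W N2W by auto
        have c2: "2 \<le> card D" using 3 W(3) pos by (metis One_nat_def Suc_1 Suc_leI le_neq_implies_less odd_one)
        \<comment> \<open>Starting at the tail of \<open>b\<close> makes \<open>y1\<close> and
          \<open>y2\<close> consecutive, in whichever order \<open>o2\<close> visits them.\<close>
        define y where "y = otail G o2 b"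
        have "y \<in> {y1, y2}" "{y1, y2} = {y, ?s y}"
          using b_dir succ_eq[OF bC] by (auto simp: y_def)
        then show ?thesis using 3 c2 W(3) xy SD
          by (intro exI[of _ y] exI[of _ 2]) (auto simp: two)
      qed
    qed
    then obtain y t where yt: "y \<in> vset G D" "t \<le> card D" "even (card D - t)"
      "?S \<inter> vset G D = (\<lambda>i. (?s ^^ i) y) ` {..<t}" by blast
    obtain P where P: "P \<subseteq> D" "matching G P" "vset G P = vset G D - ?S"
      by (rule circuit_matching[OF finC CE reg o2 D(1,3) yt])
    show ?thesis
      by (rule max_matching_covers[OF finC reg D(1,3) M M_edges P D(2) v(2)])
  qed
  let ?H = "((?E - C) - {a, c}) \<union> M"
  have HE: "?H \<subseteq> ?E" using M_C CE by blast
  \<comment> \<open>All edges at \<open>?S\<close> are \<open>a\<close>, \<open>c\<close> or edges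
    of \<open>C\<close> outside \<open>M\<close>, so \<open>?H\<close> avoids \<open>?S\<close>;
    every other vertex has one edge of \<open>F\<close> and one of \<open>M\<close>.\<close>
  have regH: "\<forall>v\<in>vset G ?H. degE G ?H v = 2"
  proof
    fix v assume v: "v \<in> vset G ?H"
    have vV: "v \<in> ?V" using v HE ends_V by (auto simp: vset_def)
    have vS: "v \<notin> ?S"
    proof
      assume vS: "v \<in> ?S"
      obtain e where e: "e \<in> ?H" "incident G e v" using v by (auto simp: vset_def incident_def)
      then have "e \<in> ?E - C" "e \<noteq> a" "e \<noteq> c" using M_S vS aC cC M_C by auto
      then show False
        using vS e(2) at_x1[of e] at_x2[of e] at_y1[of e] at_y2[of e] inE bC by auto
    qed
    obtain m where m: "m \<in> M" "incident G m v" using cover[OF vV vS] by blast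
    then have "v \<in> vset G M" by (rule in_vset)
    then have "degE G M v = 1" by (rule matching_degE[OF finM M_m])
    moreover have "degE G ((?E - C) - {a, c}) v = degE G (?E - C) v"
    proof (rule degE_closed)
      show "k \<in> (?E - C) - {a, c}" if "k \<in> ?E - C" "incident G k v" for k
        using that joins_ends[OF a(2)] joins_ends[OF c(2)] vS by (auto simp: incident_def)
    qed blast
    moreover have "degE G ?H v = degE G ((?E - C) - {a, c}) v + degE G M v"
      using fin finM M_C by (intro degE_Un_disjoint) auto
    ultimately show "degE G ?H v = 2" using degF[OF vV] by simp
  qed
  \<comment> \<open>The absolute values of (\<open>\<phi>1\<close>, \<open>\<phi>2\<close>) are (1,
    2) on \<open>F\<close> apart from \<open>a\<close>, \<open>c\<close>; (2, 1) on
    \<open>C - M\<close>; and on \<open>M\<close> they are (3, 1) where \<open>o1\<close>,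
    \<open>o2\<close> agree and (1, 3) where they differ. The opposite signs of the \<open>C\<close>
    coefficients reverse the edges of \<open>C - M\<close> between the two flows.\<close>
  define \<phi>1 where "\<phi>1 e = 1 * unit_flow o1 ?H e + 2 * unit_flow o2 C e" for e
  define \<phi>2 where "\<phi>2 e = 2 * unit_flow o1 ?H e + (-1) * unit_flow o2 C e" for e
  have flows: "is_flow G \<phi>1" "is_flow G \<phi>2"
    unfolding \<phi>1_def[abs_def] \<phi>2_def[abs_def]
    by (intro is_flow_lincomb unit_flow_is_flow[OF fin HE regH o1] unit_flow_is_flow[OF fin CE reg o2])+
  have zero: "\<phi>1 k = 0 \<longleftrightarrow> k \<in> {a, c}" "\<phi>2 k = 0 \<longleftrightarrow> k \<in> {a, c}" if "k \<in> ?E" for k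
    using that aC cC M_C by (auto simp: \<phi>1_def \<phi>2_def unit_flow_def)
  have one: "\<bar>\<phi>1 e\<bar> = 1 \<or> \<bar>\<phi>2 e\<bar> = 1" if "e \<in> ?E" "e \<notin> {a, c}" for e
    using that M_C by (auto simp: \<phi>1_def \<phi>2_def unit_flow_def)
  have C_M: "f1 \<notin> M" "g1 \<notin> M" "f2 \<notin> M" "g2 \<notin> M" "h1 \<notin> M" "h2 \<notin> M" "b \<notin> M"
    using M_S joins_inc(1)[OF uv1(4)] joins_inc(1)[OF uv1(5)] joins_inc(1)[OF uv2(4)] joins_inc(1)[OF uv2(5)]
      joins_inc(1)[OF w1(3)] joins_inc(1)[OF w2(3)] joins_inc(1)[OF b(2)] by blast+
  have CM_val: "\<bar>\<phi>1 e\<bar> = 2" "\<bar>\<phi>2 e\<bar> = 1" if "e \<in> C" "e \<notin> M" for e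
    using that by (auto simp: \<phi>1_def \<phi>2_def unit_flow_def)
  have CM_dir: "ftail G \<phi>1 e = otail G o2 e" "fhead G \<phi>1 e = ohead G o2 e"
    "ftail G \<phi>2 e = ohead G o2 e" "fhead G \<phi>2 e = otail G o2 e" if "e \<in> C" "e \<notin> M" for e
    using that by (auto simp: \<phi>1_def \<phi>2_def unit_flow_def otail_def ohead_def)
  \<comment> \<open>The \<open>M\<close>-edge at such a neighbour of \<open>x1\<close> or
    \<open>x2\<close> is among those on which \<open>o1\<close> and \<open>o2\<close> agree, so its
    two contributions add up to 1 + 2.\<close>
  have big: "\<exists>m\<in>cut G {v}. 3 \<le> \<bar>\<phi>1 m\<bar>" if v: "v \<in> {u1, v1, u2, v2}" for v
  proof -
    have vN: "v \<in> {u1, v1} \<and> v \<in> vset G N1 \<or> v \<in> {u2, v2} \<and> v \<in> vset G N2"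
      using v circ_ends(2)[OF uv1(4,1)] circ_ends(2)[OF uv1(5,2)] circ_ends(2)[OF uv2(4,1)] circ_ends(2)[OF uv2(5,2)]
      by blast
    then have "v \<in> vset G C" using N(2,5) by (auto simp: vset_def)
    moreover have "v \<notin> ?S" using v u1S u2S by blast
    ultimately obtain m where m: "m \<in> M" "incident G m v" using cover vC by blast
    have mC: "m \<in> C" using m M_C by blast
    have mx: "\<not> incident G m x1" "\<not> incident G m x2" using M_S[OF m(1)] by auto
    have "m \<in> N1 \<and> v \<in> {u1, v1} \<or> m \<in> N2 \<and> v \<in> {u2, v2}"
      using vN absorb[OF N(1,2) _ mC m(2)] absorb[OF N(4,5) _ mC m(2)] by blast
    then have "o1 m = o2 m" using agree mx m(2) by blast
    then have "\<bar>\<phi>1 m\<bar> = 3" using m(1) mC by (auto simp: \<phi>1_def unit_flow_def)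
    moreover have "m \<in> cut G {v}" using m(2) mC CE noloop[of m] by (auto simp: cut_def incident_def)
    ultimately show ?thesis by (intro bexI[of _ m]) simp_all
  qed
  \<comment> \<open>Of the two edges at \<open>x\<close>, \<open>p\<close> is the one by which
    \<open>o2\<close> enters and \<open>q\<close> the one by which it leaves.\<close>
  have pass: "\<exists>p q s t. {p, q} = {f, g} \<and> {s, t} = {u, v} \<and>
      otail G o2 p = s \<and> ohead G o2 p = x \<and> otail G o2 q = x \<and> ohead G o2 q = t"
    if "f \<in> C" "g \<in> C" "f \<noteq> g" "joins G f x u" "joins G g x v" for f g x u v
  proof -
    have ne: "x \<noteq> u" "x \<noteq> v" using joins_ne that CE by blast+
    have f: "otail G o2 f = x \<and> ohead G o2 f = u \<or> otail G o2 f = u \<and> ohead G o2 f = x"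
      and g: "otail G o2 g = x \<and> ohead G o2 g = v \<or> otail G o2 g = v \<and> ohead G o2 g = x"
      using joins_ends[OF that(4)] joins_ends[OF that(5)] by (auto simp: otail_def ohead_def)
    have "\<not> (otail G o2 f = x \<and> otail G o2 g = x)"
      using out_edge_eq[OF finC CE reg o2 that(1)] out_edge_eq[OF finC CE reg o2 that(2)] that(3) by auto
    moreover have "\<not> (ohead G o2 f = x \<and> ohead G o2 g = x)"
      using in_edge_unique[OF finC CE reg o2 that(1,2)] that(3) by auto
    ultimately consider "otail G o2 f = u" "ohead G o2 f = x" "otail G o2 g = x" "ohead G o2 g = v"
      | "otail G o2 g = v" "ohead G o2 g = x" "otail G o2 f = x" "ohead G o2 f = u"
      using f g by blast
    then show ?thesis
    proof cases
      case 1
      then show ?thesis by blast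
    next
      case 2
      then show ?thesis by (intro exI[of _ g] exI[of _ f] exI[of _ v] exI[of _ u]) auto
    qed
  qed
  obtain p1 q1 s1 t1 where P1: "{p1, q1} = {f1, g1}" "{s1, t1} = {u1, v1}"
    "otail G o2 p1 = s1" "ohead G o2 p1 = x1" "otail G o2 q1 = x1" "ohead G o2 q1 = t1"
    using pass[OF inE(1,2) uv1(3,4,5)] by blast
  obtain p2 q2 s2 t2 where P2: "{p2, q2} = {f2, g2}" "{s2, t2} = {u2, v2}"
    "otail G o2 p2 = s2" "ohead G o2 p2 = x2" "otail G o2 q2 = x2" "ohead G o2 q2 = t2"
    using pass[OF inE(3,4) uv2(3,4,5)] by blast
  have pqC: "p1 \<in> C" "q1 \<in> C" "p2 \<in> C" "q2 \<in> C" using P1(1) P2(1) inE by (auto simp: doubleton_eq_iff)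
  have pqM: "p1 \<notin> M" "q1 \<notin> M" "p2 \<notin> M" "q2 \<notin> M" using P1(1) P2(1) C_M by (auto simp: doubleton_eq_iff)
  have st: "s1 \<in> {u1, v1}" "t1 \<in> {u1, v1}" "s2 \<in> {u2, v2}" "t2 \<in> {u2, v2}"
    using P1(2) P2(2) by (auto simp: doubleton_eq_iff)
  have stS: "s1 \<notin> ?S" "t1 \<notin> ?S" "s2 \<notin> ?S" "t2 \<notin> ?S" using st u1S u2S by auto
  have bigst: "\<exists>m\<in>cut G {v}. 3 \<le> \<bar>\<phi>1 m\<bar>" if "v \<in> {s1, t1, s2, t2}" for v
    using big[of v] that st by blast
  have sp: "{a, c, b, p1, q1, p2, q2, h1, h2} = ?sp" using P1(1) P2(1) by auto
  have vals: "\<bar>\<phi>1 e\<bar> = 2" "\<bar>\<phi>2 e\<bar> = 1" if "e \<in> {b, p1, q1, p2, q2, h1, h2}" for e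
    using CM_val[of e] that pqC pqM inE bC C_M by blast+
  have dirs: "ftail G \<phi>1 e = otail G o2 e" "fhead G \<phi>1 e = ohead G o2 e"
    "ftail G \<phi>2 e = ohead G o2 e" "fhead G \<phi>2 e = otail G o2 e" if "e \<in> {b, p1, q1, p2, q2, h1, h2}" for e
    using CM_dir[of e] that pqC pqM inE bC C_M by blast+
  have h1_dir: "otail G o2 h1 = y1 \<and> ohead G o2 h1 = w1 \<or> otail G o2 h1 = w1 \<and> ohead G o2 h1 = y1"
    and h2_dir: "otail G o2 h2 = y2 \<and> ohead G o2 h2 = w2 \<or> otail G o2 h2 = w2 \<and> ohead G o2 h2 = y2"
    using joins_ends[OF w1(3)] joins_ends[OF w2(3)] by (auto simp: otail_def ohead_def)
  have no_tail: "\<not> (otail G o2 h1 = otail G o2 b)" "\<not> (otail G o2 h2 = otail G o2 b)"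
    using out_edge_eq[OF finC CE reg o2] inE bC w1(2) w2(2) by metis+
  have no_head: "\<not> (ohead G o2 h1 = ohead G o2 b)" "\<not> (ohead G o2 h2 = ohead G o2 b)"
    using in_edge_unique[OF finC CE reg o2] inE bC w1(2) w2(2) by metis+
  have conn': "\<forall>X\<subseteq>?V. X \<noteq> {} \<longrightarrow> X \<noteq> ?V \<longrightarrow> 3 \<le> card (cut G X)" using conn by blast
  have joins_sym: "joins G e p q \<Longrightarrow> joins G e q p" for e p q by (auto simp: joins_def)
  have "\<exists>O1 O2. \<forall>e\<in>?E. deletable G O1 e \<or> deletable G O2 e"
  proof (cases "otail G o2 b = y1")
    case True
    then have d: "otail G o2 b = y1" "ohead G o2 b = y2" "otail G o2 h1 = w1" "ohead G o2 h1 = y1" "otail G o2 h2 = y2" "ohead G o2 h2 = w2"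
      using b_dir h1_dir h2_dir no_tail no_head dist by auto
    have "deletable G (bridge_ori G \<phi>1 a x1 c y2) e \<or> deletable G (bridge_ori G \<phi>2 a x1 c y2) e" if e: "e \<in> ?E" for e
    proof (rule two_orientations[where b = b and ?f1.0 = p1 and ?g1.0 = q1 and ?f2.0 = p2 and ?g2.0 = q2
          and ?h1.0 = h1 and ?h2.0 = h2, OF wf conn' _ a c dist])
      show "is_flow G \<phi>1" "is_flow G \<phi>2" by (fact flows)+
      show "\<exists>v. X = {v} \<or> ?V - X = {v}" if "X \<subseteq> ?V" "X \<noteq> {}" "X \<noteq> ?V" "card (cut G X) \<le> 3" for X
        using triv that by blast
      show "3 \<le> card (cut G X - {a, c})"
        if "X \<subseteq> ?V" "k \<in> cut G X" "k \<notin> {a, c, b, p1, q1, p2, q2, h1, h2}" for X k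
        using off[OF that(1,2)] that(3) unfolding sp by blast
      show "\<forall>k\<in>?E. \<phi>1 k = 0 \<longleftrightarrow> k \<in> {a, c}" "\<forall>k\<in>?E. \<phi>2 k = 0 \<longleftrightarrow> k \<in> {a, c}"
        using zero by auto
      show "\<bar>\<phi>1 k\<bar> = 1 \<or> \<bar>\<phi>2 k\<bar> = 1" if "k \<in> ?E" "k \<notin> {a, c, b, p1, q1, p2, q2, h1, h2}" for k
        using one[OF that(1)] that(2) by blast
      show "b \<in> ?E" "p1 \<in> ?E" "q2 \<in> ?E" using pqC bC CE by auto
      show "ftail G \<phi>1 p1 = s1" "fhead G \<phi>1 p1 = x1" "ftail G \<phi>1 b = y1" "fhead G \<phi>1 b = y2"
        "ftail G \<phi>1 q2 = x2" "fhead G \<phi>1 q2 = t2" "ftail G \<phi>2 q1 = t1" "fhead G \<phi>2 q1 = x1"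
        "ftail G \<phi>2 p2 = x2" "fhead G \<phi>2 p2 = s2" "ftail G \<phi>2 h1 = y1" "fhead G \<phi>2 h1 = w1"
        "ftail G \<phi>2 h2 = w2" "fhead G \<phi>2 h2 = y2"
        by (simp_all add: dirs P1 P2 d)
      show "\<bar>\<phi>1 p1\<bar> = 2" "\<bar>\<phi>1 b\<bar> = 2" "\<bar>\<phi>1 q2\<bar> = 2" "\<bar>\<phi>2 q1\<bar> = 1" "\<bar>\<phi>2 p2\<bar> = 1"
        "\<bar>\<phi>2 h1\<bar> = 1" "\<bar>\<phi>2 h2\<bar> = 1"
        by (simp_all add: vals)
      show "\<exists>m\<in>cut G {s1}. 3 \<le> \<bar>\<phi>1 m\<bar>" "\<exists>m\<in>cut G {t2}. 3 \<le> \<bar>\<phi>1 m\<bar>" using bigst by auto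
      show "t1 \<notin> {x2, y2}" "s2 \<notin> {x1, y1}" "w1 \<notin> {x2, y2}" "w2 \<notin> {x1, y1}"
        using stS w1S by auto
    qed (rule e)
    then show ?thesis by blast
  next
    \<comment> \<open>Now \<open>o2\<close> traverses \<open>b\<close> from \<open>y2\<close> to
      \<open>y1\<close>; exchanging the indices 1 and 2, and with them \<open>a\<close> and
      \<open>c\<close>, restores the hypotheses of \<open>two_orientations\<close>.\<close>
    case False
    then have d: "otail G o2 b = y2" "ohead G o2 b = y1" "otail G o2 h1 = y1" "ohead G o2 h1 = w1"
      "otail G o2 h2 = w2" "ohead G o2 h2 = y2"
      using b_dir h1_dir h2_dir no_tail no_head dist by auto
    have sp': "{c, a, b, p2, q2, p1, q1, h2, h1} = ?sp"
      unfolding sp[symmetric] by (simp add: insert_commute)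
    have dist': "distinct [x2, y2, y1, x1]" using dist by auto
    have "deletable G (bridge_ori G \<phi>1 c x2 a y1) e \<or> deletable G (bridge_ori G \<phi>2 c x2 a y1) e" if e: "e \<in> ?E" for e
    proof (rule two_orientations[where b = b and ?f1.0 = p2 and ?g1.0 = q2 and ?f2.0 = p1 and ?g2.0 = q1
          and ?h1.0 = h2 and ?h2.0 = h1, OF wf conn' _ c(1) joins_sym[OF c(2)] a(1) joins_sym[OF a(2)] dist'])
      show "is_flow G \<phi>1" "is_flow G \<phi>2" by (fact flows)+
      show "\<exists>v. X = {v} \<or> ?V - X = {v}" if "X \<subseteq> ?V" "X \<noteq> {}" "X \<noteq> ?V" "card (cut G X) \<le> 3" for X
        using triv that by blast
      show "3 \<le> card (cut G X - {c, a})"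
        if "X \<subseteq> ?V" "k \<in> cut G X" "k \<notin> {c, a, b, p2, q2, p1, q1, h2, h1}" for X k
        using off[OF that(1,2)] that(3) unfolding sp' insert_commute[of c a "{}"] by blast
      show "\<forall>k\<in>?E. \<phi>1 k = 0 \<longleftrightarrow> k \<in> {c, a}" "\<forall>k\<in>?E. \<phi>2 k = 0 \<longleftrightarrow> k \<in> {c, a}"
        using zero by auto
      show "\<bar>\<phi>1 k\<bar> = 1 \<or> \<bar>\<phi>2 k\<bar> = 1" if "k \<in> ?E" "k \<notin> {c, a, b, p2, q2, p1, q1, h2, h1}" for k
        using one[OF that(1)] that(2) by blast
      show "b \<in> ?E" "p2 \<in> ?E" "q1 \<in> ?E" using pqC bC CE by auto
      show "ftail G \<phi>1 p2 = s2" "fhead G \<phi>1 p2 = x2" "ftail G \<phi>1 b = y2" "fhead G \<phi>1 b = y1"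
        "ftail G \<phi>1 q1 = x1" "fhead G \<phi>1 q1 = t1" "ftail G \<phi>2 q2 = t2" "fhead G \<phi>2 q2 = x2"
        "ftail G \<phi>2 p1 = x1" "fhead G \<phi>2 p1 = s1" "ftail G \<phi>2 h2 = y2" "fhead G \<phi>2 h2 = w2"
        "ftail G \<phi>2 h1 = w1" "fhead G \<phi>2 h1 = y1"
        by (simp_all add: dirs P1 P2 d)
      show "\<bar>\<phi>1 p2\<bar> = 2" "\<bar>\<phi>1 b\<bar> = 2" "\<bar>\<phi>1 q1\<bar> = 2" "\<bar>\<phi>2 q2\<bar> = 1" "\<bar>\<phi>2 p1\<bar> = 1"
        "\<bar>\<phi>2 h2\<bar> = 1" "\<bar>\<phi>2 h1\<bar> = 1"
        by (simp_all add: vals)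
      show "\<exists>m\<in>cut G {s2}. 3 \<le> \<bar>\<phi>1 m\<bar>" "\<exists>m\<in>cut G {t1}. 3 \<le> \<bar>\<phi>1 m\<bar>" using bigst by auto
      show "t2 \<notin> {x1, y1}" "s1 \<notin> {x2, y2}" "w2 \<notin> {x1, y1}" "w1 \<notin> {x2, y2}"
        using stS w1S by auto
    qed (rule e)
    then show ?thesis by blast
  qed
  then obtain O1 O2 where OO: "\<forall>e\<in>?E. deletable G O1 e \<or> deletable G O2 e" by blast
  let ?P = "\<lambda>k. \<exists>Os :: nat \<Rightarrow> 'e \<Rightarrow> bool. \<forall>e\<in>?E. \<exists>i<k. deletable G (Os i) e"
  have two: "?P 2"
  proof (intro exI[of _ "\<lambda>i. if i = 0 then O1 else O2"] ballI)
    fix e assume "e \<in> ?E"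
    then consider "deletable G O1 e" | "deletable G O2 e" using OO by blast
    then show "\<exists>i<2::nat. deletable G (if i = 0 then O1 else O2) e"
    proof cases
      case 1
      then show ?thesis by (intro exI[of _ 0]) simp
    next
      case 2
      then show ?thesis by (intro exI[of _ 1]) simp
    qed
  qed
  \<comment> \<open>For \<open>k < 2\<close> at most the orientation \<open>Os 0\<close> is
    available, and every orientation has an undeletable edge.\<close>
  have nP: "\<not> ?P k" if "k < 2" for k
  proof
    assume "?P k"
    then obtain Os :: "nat \<Rightarrow> 'e \<Rightarrow> bool" where Os: "\<forall>e\<in>?E. \<exists>i<k. deletable G (Os i) e" by blast
    obtain e where e: "e \<in> ?E" "\<not> deletable G (Os 0) e"
      using ex_not_deletable[OF cubic xV(1,2)] dist by auto
    then show False using Os that by (auto simp: less_2_cases_iff)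
  qed
  show ?thesis
    unfolding fn_def
  proof (rule Least_equality)
    show "2 \<le> k" if "?P k" for k using nP[of k] that by (meson not_le)
  qed (rule two)
qed

end
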